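(* Let $\varphi:[0,\infty]\to[0,\infty]$ be a monotone increasing function with $\lim_{t\to0^+}\varphi(t)=0$, and let $\mathcal{H}^\varphi_\infty$ be the dyadic content associated to $\varphi$. Let $Q_0\in\mathcal{D}(Q)$. Then there exist constants $c,C>0$ such that $$\mathcal{H}^\varphi_\infty\left(\{x\in Q':|f(x)-c_{Q'}|>t\}\right)\le C\,\mathcal{H}^\varphi_\infty(Q')\exp\left(-ct/\|f\|_{BMO^{\mathcal{H}^\varphi_\infty}(Q_0)}\right)$$ for every $t>0$, every $f\in BMO^{\mathcal{H}^\varphi_\infty}(Q_0)$, and every finite subcube $Q'\in\mathcal{D}(Q_0)$, where $$c_{Q'}=\operatorname*{arg\,min}_{c\in\mathbb{R}}\frac{1}{\mathcal{H}^\varphi_\infty(Q')}\int_{Q'}|f-c|\,d\mathcal{H}^\varphi_\infty .$$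
   Context: Dyadic cubes. Fix a half-open cube $Q=[x_1,x_1+\ell)\times\cdots\times[x_n,x_n+\ell)\subset\mathbb{R}^n$, $\ell>0$, and put $x_Q=(x_1,\dots,x_n)$. Let $\mathcal{D}_0(Q)=\{x_Q+2^k\ell(m+[0,1)^n): k\in\mathbb{Z}, m\in\mathbb{Z}^n\}$ and $\mathcal{D}(Q)=\mathcal{D}_0(Q)\cup\{\prod_{i=1}^n I_i: I_i=[x_i,\infty)\text{ or }(-\infty,x_i)\}$. Elements of $\mathcal{D}(Q)$ are called dyadic cubes (finite if in $\mathcal{D}_0(Q)$, infinite otherwise); $l(Q')\in(0,\infty]$ denotes the side length. For $Q_0\in\mathcal{D}(Q)$ (possibly infinite), $\mathcal{D}(Q_0)$ here denotes the set of cubes $Q'\in\mathcal{D}(Q)$ with $Q'\subset Q_0$. Dyadic content. $\mathcal{H}^\varphi_\infty(E)=\inf\{\sum_i\varphi(l(Q_i)): E\subset\bigcup_iQ_i,\ Q_i\in\mathcal{D}(Q)\}$ (countable covers). "Monotone increasing" means non-decreasing. Choquet integral. $\int_A f\,dH=\int_0^\infty H(\{x\in A: f(x)>t\})\,dt$ for $f\ge0$. Convention $0\cdot\infty=0$, and an average over a set of zero content is $0$. BMO. For real-valued $f$ on $Q_0$, $\mathcal{M}^{\#}_{\mathcal{H}^\varphi_\infty}f(x)=\sup_{x\in Q'\in\mathcal{D}(Q_0)}\inf_{c\in\mathbb{R}}\frac{1}{\mathcal{H}^\varphi_\infty(Q')}\int_{Q'}|f-c|\,d\mathcal{H}^\varphi_\infty$,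 $\|f\|_{BMO^{\mathcal{H}^\varphi_\infty}(Q_0)}=\|\mathcal{M}^{\#}_{\mathcal{H}^\varphi_\infty}f\|_{L^\infty(Q_0)}$, and $f\in BMO^{\mathcal{H}^\varphi_\infty}(Q_0)$ means this is finite. If the norm is $0$, the exponential is read as $0$. $c_{Q'}$ denotes a minimizer. *)

theory Defs
  imports "HOL-Analysis.Analysis" "HOL-Probability.Essential_Supremum"
begin

definition hcube :: "real ^ 'n \<Rightarrow> real \<Rightarrow> (real ^ 'n) set" where
  "hcube a s = {y. \<forall>i. a $ i \<le> y $ i \<and> y $ i < a $ i + s}"

(* The half-open cube Q = hcube x l enters through its corner x and side length l throughout. *)

definition finite_dyadic :: "real ^ 'n \<Rightarrow> real \<Rightarrow> (real ^ 'n) set set" where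
  "finite_dyadic x l =
    {hcube (x + (2 powi k * l) *\<^sub>R (\<chi> i. of_int (m $ i))) (2 powi k * l) | (k :: int) (m :: int ^ 'n). True}"

definition infinite_dyadic :: "real ^ 'n \<Rightarrow> (real ^ 'n) set set" where
  "infinite_dyadic x =
    {{y. \<forall>i. y $ i \<in> I i} | I. \<forall>i. I i = {x $ i..} \<or> I i = {..<x $ i}}"

definition dyadic :: "real ^ 'n \<Rightarrow> real \<Rightarrow> (real ^ 'n) set set" where
  "dyadic x l = finite_dyadic x l \<union> infinite_dyadic x"

definition side_length :: "(real ^ 'n) set \<Rightarrow> ennreal" where
  "side_length R =
    (if \<exists>a s. 0 < s \<and> R = hcube a s then ennreal (THE s. \<exists>a. 0 < s \<and> R = hcube a s) else \<infinity>)"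

lemma hcube_inj_side:
  fixes a b :: "real ^ 'n"
  assumes "0 < s" "0 < r" "hcube a s = hcube b r"
  shows "s = r"
proof -
  have ineq: "r' \<le> s'" if "0 < s'" "0 < r'" "hcube a' s' = hcube b' r'" for a' b' :: "real ^ 'n" and s' r'
  proof (rule field_le_epsilon)
    fix e :: real assume e: "0 < e"
    define d where "d = min (r' / 2) (e / 2)"
    have d: "0 < d" "d < r'" "d < e" using that e by (auto simp: d_def min_def)
    have 1: "b' \<in> hcube a' s'" using that by (auto simp: hcube_def)
    have 2: "(\<chi> i. b' $ i + (r' - d)) \<in> hcube a' s'" using that d by (auto simp: hcube_def)
    have "a' $ undefined \<le> b' $ undefined" "b' $ undefined + (r' - d) < a' $ undefined + s'"
      using 1 2 by (auto simp: hcube_def)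
    then show "r' \<le> s' + e" using d by linarith
  qed
  from ineq[OF assms(1,2,3)] ineq[OF assms(2,1) assms(3)[symmetric]] show ?thesis by simp
qed

lemma side_length_hcube:
  assumes "0 < s"
  shows "side_length (hcube a s) = ennreal s"
proof -
  have "(THE r. \<exists>b. 0 < r \<and> hcube a s = hcube b r) = s"
    using assms hcube_inj_side by (intro the_equality) blast+
  then show ?thesis using assms unfolding side_length_def by auto
qed

lemma side_length_infinite_dyadic:
  fixes x :: "real ^ 'n"
  assumes "R \<in> infinite_dyadic x"
  shows "side_length R = \<infinity>"
proof -
  obtain I where R: "R = {y. \<forall>i. y $ i \<in> I i}" and I: "\<And>i. I i = {x $ i..} \<or> I i = {..<x $ i}"
    using assms unfolding infinite_dyadic_def by blast
  have False if "0 < s" "R = hcube a s" for a :: "real ^ 'n" and s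
  proof -
    let ?y = "\<chi> i. if I i = {x $ i..} then max (x $ i) (a $ i + s) else min (x $ i - 1) (a $ i - 1)"
    have "?y $ i \<in> I i" for i using I[of i] by (cases "I i = {x $ i..}") auto
    then have "?y \<in> R" unfolding R by blast
    moreover have "?y \<notin> hcube a s" by (auto simp: hcube_def not_le not_less intro!: exI[of _ undefined])
    ultimately show False using that by simp
  qed
  then show ?thesis unfolding side_length_def by auto
qed

definition dyadic_content :: "(ennreal \<Rightarrow> ennreal) \<Rightarrow> real ^ 'n \<Rightarrow> real \<Rightarrow> (real ^ 'n) set \<Rightarrow> ennreal" where
  "dyadic_content \<phi> x l E =
    Inf {\<Sum>\<^sub>\<infinity>R\<in>\<C>. \<phi> (side_length R) | \<C>. countable \<C> \<and> \<C> \<subseteq> dyadic x l \<and> E \<subseteq> \<Union>\<C>}"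

definition choquet_integral :: "('a set \<Rightarrow> ennreal) \<Rightarrow> 'a set \<Rightarrow> ('a \<Rightarrow> real) \<Rightarrow> ennreal" where
  "choquet_integral H A g = (\<integral>\<^sup>+ t\<in>{0<..}. H {y \<in> A. t < g y} \<partial>lborel)"

(* If H A = \<infinity>, then 1 / H A = 0, and 0 * \<infinity> = 0 holds in ennreal. *)

definition choquet_average :: "('a set \<Rightarrow> ennreal) \<Rightarrow> 'a set \<Rightarrow> ('a \<Rightarrow> real) \<Rightarrow> ennreal" where
  "choquet_average H A g = (if H A = 0 then 0 else 1 / H A * choquet_integral H A g)"

definition sharp_maximal ::
    "(ennreal \<Rightarrow> ennreal) \<Rightarrow> real ^ 'n \<Rightarrow> real \<Rightarrow> (real ^ 'n) set \<Rightarrow> (real ^ 'n \<Rightarrow> real) \<Rightarrow> real ^ 'n \<Rightarrow> ennreal" where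
  "sharp_maximal \<phi> x l Q0 f y =
    (SUP Q' \<in> {Q' \<in> dyadic x l. Q' \<subseteq> Q0 \<and> y \<in> Q'}.
       INF c. choquet_average (dyadic_content \<phi> x l) Q' (\<lambda>z. \<bar>f z - c\<bar>))"

(* The essential supremum is taken with respect to Lebesgue measure. Every dyadic cube has positive
   measure, so it equals the supremum of the sharp maximal function over Q0. *)

definition BMO_norm ::
    "(ennreal \<Rightarrow> ennreal) \<Rightarrow> real ^ 'n \<Rightarrow> real \<Rightarrow> (real ^ 'n) set \<Rightarrow> (real ^ 'n \<Rightarrow> real) \<Rightarrow> ennreal" where
  "BMO_norm \<phi> x l Q0 f = esssup (lebesgue_on Q0) (sharp_maximal \<phi> x l Q0 f)"

(* Functions are total, but only the values on Q0 matter. *)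

definition BMO ::
    "(ennreal \<Rightarrow> ennreal) \<Rightarrow> real ^ 'n \<Rightarrow> real \<Rightarrow> (real ^ 'n) set \<Rightarrow> (real ^ 'n \<Rightarrow> real) set" where
  "BMO \<phi> x l Q0 = {f. BMO_norm \<phi> x l Q0 f < \<infinity>}"

definition is_oscillation_minimizer ::
    "(ennreal \<Rightarrow> ennreal) \<Rightarrow> real ^ 'n \<Rightarrow> real \<Rightarrow> (real ^ 'n) set \<Rightarrow> (real ^ 'n \<Rightarrow> real) \<Rightarrow> real \<Rightarrow> bool" where
  "is_oscillation_minimizer \<phi> x l Q' f =
    is_arg_min (\<lambda>c. choquet_average (dyadic_content \<phi> x l) Q' (\<lambda>z. \<bar>f z - c\<bar>)) (\<lambda>c. True)"

definition exp_decay :: "real \<Rightarrow> real \<Rightarrow> ennreal \<Rightarrow> real" where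
  "exp_decay c t N = (if N = 0 then 0 else exp (- (c * t) / enn2real N))"

end

(*
Cubes of equal side have equal content by translation, so the content of a cube is at most 2^n times
that of a child.  Let E be the part of a cube R where |f - c_R| exceeds a large multiple s of the
norm; by Chebyshev, E has small content.  Take an almost optimal dyadic cover of E, add to it all
cubes T in R with H(T) <= 2 H(E inter T), and keep the maximal cubes S.  Maximality and the
near-optimality of the cover give sum H(S) <= H(R)/2, which replaces the additivity that a content
lacks.  The parent P of each S is not among the added cubes, so more than half of P lies outside E;
together with the doubling bound this forces |c_S - c_R| <= 4 s.  Iterating inside the cubes S, the
content of {|f - c_R| > 4 s m} decays like 2^-m.
*)
theory Submission
  imports Defs
begin

text \<open>Since \<phi> need not be doubling and may be infinite at large sides, cubes are weighed
  by their content and not by \<phi> of their side. The classical stopping rule, on averages of f,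
  relies on Lebesgue differentiation outside the stopping cubes, whereas here f is an arbitrary real
  function. Stopping on the share of E in a cube avoids this: the cover of E is itself among the
  candidates, so the maximal cubes contain all of E, with no exceptional set. Infinite cubes occur
  only as Q0 or in covers. A cheap cover of E has none that meets R, because such a cube would
  contain R and cost at least H(R). Constants: H(E) <= H(R)/8 admits a cover of cost below H(R)/4,
  and the factor 2 in the stopping rule turns this into H(R)/2. Chebyshev is applied at s = 8 * 2^n
  * norm; the extra 2^n pays for comparing the exceptional set of a parent with the content of its
  child. One iteration costs 4 s, whence c = ln 2 / (32 * 2^n) and C = 2, which depend on the
  dimension only.\<close>

section \<open>Sums in the extended nonnegative reals\<close>

lemma infsum_ennreal_mono_set:
  fixes f :: "'a \<Rightarrow> ennreal"
  assumes "A \<subseteq> B"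
  shows "(\<Sum>\<^sub>\<infinity>a\<in>A. f a) \<le> (\<Sum>\<^sub>\<infinity>a\<in>B. f a)"
  using assms by (intro infsum_mono_neutral) (auto intro: nonneg_summable_on_complete)

text \<open>Gives unordered sums access to integration theory: scaling and the exchange of sums
  below are linearity and monotone convergence for counting measure.\<close>

lemma infsum_ennreal_eq_nn_integral:
  fixes f :: "'a \<Rightarrow> ennreal"
  assumes "countable A"
  shows "(\<Sum>\<^sub>\<infinity>a\<in>A. f a) = (\<integral>\<^sup>+a. f a \<partial>count_space A)"
proof (rule antisym)
  have "(\<Sum>\<^sub>\<infinity>a\<in>A. f a) = (SUP F\<in>{F. finite F \<and> F \<subseteq> A}. sum f F)"
    by (simp add: nonneg_infsum_complete)
  also have "\<dots> \<le> (\<integral>\<^sup>+a. f a \<partial>count_space A)"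
  proof (rule SUP_least)
    fix F assume "F \<in> {F. finite F \<and> F \<subseteq> A}"
    then have F: "finite F" "F \<subseteq> A" by auto
    have "sum f F = (\<integral>\<^sup>+a. f a \<partial>count_space F)" using F by (simp add: nn_integral_count_space_finite)
    also have "\<dots> = (\<integral>\<^sup>+a. f a * indicator F a \<partial>count_space UNIV)"
      by (simp add: nn_integral_count_space_indicator)
    also have "\<dots> \<le> (\<integral>\<^sup>+a. f a * indicator A a \<partial>count_space UNIV)"
      using F by (intro nn_integral_mono) (auto split: split_indicator)
    also have "\<dots> = (\<integral>\<^sup>+a. f a \<partial>count_space A)"
      by (simp add: nn_integral_count_space_indicator)
    finally show "sum f F \<le> (\<integral>\<^sup>+a. f a \<partial>count_space A)" .
  qed
  finally show "(\<Sum>\<^sub>\<infinity>a\<in>A. f a) \<le> (\<integral>\<^sup>+a. f a \<partial>count_space A)" .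
  show "(\<integral>\<^sup>+a. f a \<partial>count_space A) \<le> (\<Sum>\<^sub>\<infinity>a\<in>A. f a)"
  proof (cases "finite A")
    case True then show ?thesis by (simp add: nn_integral_count_space_finite)
  next
    case False
    let ?g = "from_nat_into A"
    have bij: "bij_betw ?g UNIV A" using bij_betw_from_nat_into[OF assms False] .
    have "(\<integral>\<^sup>+a. f a \<partial>count_space A) = (\<integral>\<^sup>+n. f (?g n) \<partial>count_space UNIV)"
      using nn_integral_bij_count_space[OF bij] by simp
    also have "\<dots> = (\<Sum>n. f (?g n))" by (rule nn_integral_count_space_nat)
    also have "\<dots> \<le> (\<Sum>\<^sub>\<infinity>a\<in>A. f a)"
    proof (rule suminf_le_const)
      fix n
      have "(\<Sum>i<n. f (?g i)) = sum f (?g ` {..<n})"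
        using bij by (subst sum.reindex) (auto simp: bij_betw_def intro: inj_on_subset)
      also have "\<dots> \<le> (\<Sum>\<^sub>\<infinity>a\<in>A. f a)"
        using infsum_ennreal_mono_set[of "?g ` {..<n}" A f] bij_betw_imp_surj_on[OF bij] by auto
      finally show "(\<Sum>i<n. f (?g i)) \<le> (\<Sum>\<^sub>\<infinity>a\<in>A. f a)" .
    qed simp
    finally show ?thesis .
  qed
qed

lemma infsum_ennreal_UN_le:
  fixes f :: "'a \<Rightarrow> ennreal"
  assumes "\<And>i::nat. countable (A i)"
  shows "(\<Sum>\<^sub>\<infinity>a\<in>(\<Union>i. A i). f a) \<le> (\<Sum>i. \<Sum>\<^sub>\<infinity>a\<in>A i. f a)"
proof -
  have "(\<Sum>\<^sub>\<infinity>a\<in>(\<Union>i. A i). f a) = (\<integral>\<^sup>+a. f a * indicator (\<Union>i. A i) a \<partial>count_space UNIV)"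
    using assms by (simp add: infsum_ennreal_eq_nn_integral nn_integral_count_space_indicator)
  also have "\<dots> \<le> (\<integral>\<^sup>+a. (\<Sum>i. f a * indicator (A i) a) \<partial>count_space UNIV)"
  proof (rule nn_integral_mono)
    fix a
    show "f a * indicator (\<Union>i. A i) a \<le> (\<Sum>i. f a * indicator (A i) a)"
    proof (cases "a \<in> (\<Union>i. A i)")
      case True
      then obtain i where "a \<in> A i" by auto
      then have "f a = (\<Sum>i\<in>{i}. f a * indicator (A i) a)" by simp
      also have "\<dots> \<le> (\<Sum>i. f a * indicator (A i) a)" by (rule sum_le_suminf) auto
      finally show ?thesis using True by simp
    qed simp
  qed
  also have "\<dots> = (\<Sum>i. \<integral>\<^sup>+a. f a * indicator (A i) a \<partial>count_space UNIV)"
    by (rule nn_integral_suminf) simp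
  also have "\<dots> = (\<Sum>i. \<Sum>\<^sub>\<infinity>a\<in>A i. f a)"
    using assms by (simp add: infsum_ennreal_eq_nn_integral nn_integral_count_space_indicator)
  finally show ?thesis .
qed

text \<open>Each a belongs to at most one class and is counted at most once. It will be applied with
  S the maximal cubes and \<open>P S R\<close> meaning that the cover member R lies in S.\<close>

lemma infsum_ennreal_disjoint_classes_le:
  fixes f :: "'a \<Rightarrow> ennreal" and P :: "'b \<Rightarrow> 'a \<Rightarrow> bool"
  assumes "countable A" "countable S"
    and "\<And>a s t. a \<in> A \<Longrightarrow> s \<in> S \<Longrightarrow> t \<in> S \<Longrightarrow> P s a \<Longrightarrow> P t a \<Longrightarrow> s = t"
  shows "(\<Sum>\<^sub>\<infinity>s\<in>S. \<Sum>\<^sub>\<infinity>a\<in>{a\<in>A. P s a}. f a) \<le> (\<Sum>\<^sub>\<infinity>a\<in>A. f a)"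
proof -
  have cA: "countable {a\<in>A. P s a}" for s using assms(1) by simp
  have fin: "sum (\<lambda>s. \<Sum>\<^sub>\<infinity>a\<in>{a\<in>A. P s a}. f a) F \<le> (\<Sum>\<^sub>\<infinity>a\<in>A. f a)" if F: "finite F" "F \<subseteq> S" for F
  proof -
    have "sum (\<lambda>s. \<Sum>\<^sub>\<infinity>a\<in>{a\<in>A. P s a}. f a) F
        = sum (\<lambda>s. \<integral>\<^sup>+a. f a * indicator {a\<in>A. P s a} a \<partial>count_space UNIV) F"
      using cA by (simp add: infsum_ennreal_eq_nn_integral nn_integral_count_space_indicator)
    also have "\<dots> = (\<integral>\<^sup>+a. (\<Sum>s\<in>F. f a * indicator {a\<in>A. P s a} a) \<partial>count_space UNIV)"
      by (rule nn_integral_sum[symmetric]) simp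
    also have "\<dots> \<le> (\<integral>\<^sup>+a. f a * indicator A a \<partial>count_space UNIV)"
    proof (rule nn_integral_mono)
      fix a
      show "(\<Sum>s\<in>F. f a * indicator {a\<in>A. P s a} a) \<le> f a * indicator A a"
      proof (cases "\<exists>s\<in>F. a \<in> A \<and> P s a")
        case True
        then obtain s where s: "s \<in> F" "a \<in> A" "P s a" by auto
        have "(\<Sum>s\<in>F. f a * indicator {a\<in>A. P s a} a) = (\<Sum>t\<in>{s}. f a * indicator {a\<in>A. P t a} a)"
          using F s assms(3)[of a s] by (intro sum.mono_neutral_right) (auto split: split_indicator)
        then show ?thesis using s by simp
      next
        case False
        then have "(\<Sum>s\<in>F. f a * indicator {a\<in>A. P s a} a) = 0" by (intro sum.neutral) auto
        then show ?thesis by simp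
      qed
    qed
    also have "\<dots> = (\<Sum>\<^sub>\<infinity>a\<in>A. f a)"
      using assms(1) by (simp add: infsum_ennreal_eq_nn_integral nn_integral_count_space_indicator)
    finally show ?thesis .
  qed
  have "(\<Sum>\<^sub>\<infinity>s\<in>S. \<Sum>\<^sub>\<infinity>a\<in>{a\<in>A. P s a}. f a)
      = (SUP F\<in>{F. finite F \<and> F \<subseteq> S}. sum (\<lambda>s. \<Sum>\<^sub>\<infinity>a\<in>{a\<in>A. P s a}. f a) F)"
    by (simp add: nonneg_infsum_complete)
  also have "\<dots> \<le> (\<Sum>\<^sub>\<infinity>a\<in>A. f a)" using fin by (intro SUP_least) auto
  finally show ?thesis .
qed

lemma infsum_ennreal_cmult:
  fixes f :: "'a \<Rightarrow> ennreal"
  assumes "countable A"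
  shows "(\<Sum>\<^sub>\<infinity>a\<in>A. c * f a) = c * (\<Sum>\<^sub>\<infinity>a\<in>A. f a)"
  using assms by (simp add: infsum_ennreal_eq_nn_integral nn_integral_cmult)

text \<open>Meant for t \<mapsto> H {g > t}: monotonicity in t makes this measurable even when g is
  not.\<close>

lemma borel_measurable_antimono_ennreal:
  fixes f :: "real \<Rightarrow> ennreal"
  assumes "antimono f"
  shows "f \<in> borel_measurable borel"
proof (rule borel_measurableI_greater)
  fix a
  have "is_interval {t. a < f t}"
    unfolding is_interval_1 using assms by (auto simp: antimono_def intro: less_le_trans)
  then show "{t \<in> space borel. a < f t} \<in> sets borel"
    using real_interval_borel_measurable by simp
qed

section \<open>Dyadic cubes\<close>

text \<open>The dyadic cube of side \<open>2 powi k * l\<close> that contains \<open>y\<close>. Describing a cube by one of its points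
  makes nestedness a statement about integer division by two.\<close>

definition cell :: "real ^ 'n \<Rightarrow> real \<Rightarrow> int \<Rightarrow> real ^ 'n \<Rightarrow> (real ^ 'n) set" where
  "cell x l k y = {z. \<forall>i. \<lfloor>(z $ i - x $ i) / (2 powi k * l)\<rfloor> = \<lfloor>(y $ i - x $ i) / (2 powi k * l)\<rfloor>}"

lemma cell_refl [simp]: "y \<in> cell x l k y"
  by (simp add: cell_def)

lemma cell_eq: "z \<in> cell x l k y \<Longrightarrow> cell x l k z = cell x l k y"
  by (auto simp: cell_def)

lemma floor_half: "\<lfloor>r / 2\<rfloor> = \<lfloor>r :: real\<rfloor> div 2"
  using floor_divide_real_eq_div[of 2 r] by simp

lemma index_Suc:
  "\<lfloor>r / (2 powi (k + 1) * l)\<rfloor> = \<lfloor>r / (2 powi k * l :: real)\<rfloor> div 2"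
proof -
  have "r / (2 powi (k + 1) * l) = (r / (2 powi k * l)) / 2"
    by (simp add: power_int_add field_simps)
  then show ?thesis by (simp only: floor_half)
qed

lemma cell_mono_Suc: "cell x l k y \<subseteq> cell x l (k + 1) y"
  by (auto simp: cell_def index_Suc)

lemma cell_mono:
  assumes "j \<le> k"
  shows "cell x l j y \<subseteq> cell x l k y"
  using assms
proof (induction k rule: int_ge_induct)
  case (step i) then show ?case using cell_mono_Suc[of x l i y] by blast
qed simp

lemma cell_nested:
  assumes "z \<in> cell x l j y" "z \<in> cell x l k w" "j \<le> k"
  shows "cell x l j y \<subseteq> cell x l k w"
  using cell_eq[OF assms(1)] cell_eq[OF assms(2)] cell_mono[OF assms(3), of x l z] by simp

lemma cell_eq_hcube:
  assumes "0 < l"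
  shows "cell x l k y = hcube (x + (2 powi k * l) *\<^sub>R (\<chi> i. of_int \<lfloor>(y $ i - x $ i) / (2 powi k * l)\<rfloor>)) (2 powi k * l)"
proof -
  define s where "s = 2 powi k * l"
  have s: "0 < s" using assms by (simp add: s_def)
  have "\<lfloor>(a - b) / s\<rfloor> = m \<longleftrightarrow> b + s * m \<le> a \<and> a < b + s * m + s" for a b :: real and m :: int
    using s by (simp add: floor_eq_iff field_simps)
  then show ?thesis by (simp add: cell_def hcube_def flip: s_def)
qed

lemma hcube_eq_cell:
  fixes m :: "int ^ 'n"
  assumes "0 < l"
  shows "hcube (x + (2 powi k * l) *\<^sub>R (\<chi> i. of_int (m $ i))) (2 powi k * l)
    = cell x l k (x + (2 powi k * l) *\<^sub>R (\<chi> i. of_int (m $ i)))"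
  unfolding cell_eq_hcube[OF assms] using assms by simp

lemma finite_dyadic_eq:
  assumes "0 < l"
  shows "finite_dyadic x l = {cell x l k y | k y. True}"
proof (intro subset_antisym subsetI)
  fix R assume "R \<in> finite_dyadic x l"
  then show "R \<in> {cell x l k y | k y. True}"
    using hcube_eq_cell[OF assms] by (force simp: finite_dyadic_def)
next
  fix R assume "R \<in> {cell x l k y | k y. True}"
  then obtain k y where R: "R = cell x l k y" by auto
  have "R = hcube (x + (2 powi k * l) *\<^sub>R (\<chi> i. of_int ((\<chi> i. \<lfloor>(y $ i - x $ i) / (2 powi k * l)\<rfloor>) $ i))) (2 powi k * l)"
    unfolding R cell_eq_hcube[OF assms] by simp
  then show "R \<in> finite_dyadic x l" unfolding finite_dyadic_def by blast
qed

lemma side_length_cell: "0 < l \<Longrightarrow> side_length (cell x l k y) = ennreal (2 powi k * l)"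
  by (simp add: cell_eq_hcube side_length_hcube)

text \<open>An infinite cube is an orthant with vertex x, so membership depends only on which
  coordinates satisfy x $ i <= z $ i. The cell index shows this: it is nonnegative exactly for those
  i.\<close>

lemma cell_subset_infinite:
  assumes "0 < l" "R \<in> infinite_dyadic x" "z \<in> R" "z \<in> cell x l k y"
  shows "cell x l k y \<subseteq> R"
proof
  fix w assume w: "w \<in> cell x l k y"
  obtain I where R: "R = {y. \<forall>i. y $ i \<in> I i}" and I: "\<And>i. I i = {x $ i..} \<or> I i = {..<x $ i}"
    using assms(2) unfolding infinite_dyadic_def by blast
  define s where "s = 2 powi k * l"
  have s: "0 < s" using assms by (simp add: s_def)
  have sgn: "x $ i \<le> v $ i \<longleftrightarrow> 0 \<le> \<lfloor>(v $ i - x $ i) / s\<rfloor>" for v :: "real^'a" and i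
    using s by (simp add: field_simps)
  have "x $ i \<le> w $ i \<longleftrightarrow> x $ i \<le> z $ i" for i
    using w assms(4) unfolding sgn cell_def s_def by simp
  moreover have "z $ i \<in> I i" for i using assms(3) R by auto
  ultimately have "w $ i \<in> I i" for i using I[of i] by (metis atLeast_iff lessThan_iff not_le)
  then show "w \<in> R" by (simp add: R)
qed

lemma countable_dyadic: "countable (dyadic x l)"
proof -
  have "finite_dyadic x l \<subseteq> (\<lambda>(k, m). hcube (x + (2 powi k * l) *\<^sub>R (\<chi> i. of_int (m $ i))) (2 powi k * l)) ` (UNIV :: (int \<times> (int ^ 'a)) set)"
    by (auto simp: finite_dyadic_def)
  then have 1: "countable (finite_dyadic x l)" by (rule countable_subset) simp
  define g where "g S i = (if i \<in> S then {x $ i..} else {..<x $ i})" for S i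
  have "infinite_dyadic x \<subseteq> range (\<lambda>S. {y. \<forall>i. y $ i \<in> g S i})"
  proof
    fix R assume "R \<in> infinite_dyadic x"
    then obtain I where R: "R = {y. \<forall>i. y $ i \<in> I i}" and I: "\<And>i. I i = {x $ i..} \<or> I i = {..<x $ i}"
      unfolding infinite_dyadic_def by blast
    have "I = g {i. I i = {x $ i..}}"
    proof (rule ext)
      fix i show "I i = g {i. I i = {x $ i..}} i"
        using I[of i] by (cases "I i = {x $ i..}") (simp_all add: g_def)
    qed
    then obtain S where "I = g S" by blast
    then show "R \<in> range (\<lambda>S. {y. \<forall>i. y $ i \<in> g S i})" unfolding R by blast
  qed
  then have "finite (infinite_dyadic x)" by (rule finite_subset) simp
  then show ?thesis using 1 by (simp add: dyadic_def countable_finite)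
qed

text \<open>The bound j <= k is recorded because a shift by multiples of 2 powi k * l respects only
  the grids of level at most k.\<close>

lemma dyadic_meets_cell:
  assumes "0 < l" "R \<in> dyadic x l" "R \<inter> cell x l k y \<noteq> {}"
  shows "cell x l k y \<subseteq> R \<or> (R \<subseteq> cell x l k y \<and> (\<exists>j w. j \<le> k \<and> R = cell x l j w))"
proof -
  obtain z where z: "z \<in> R" "z \<in> cell x l k y" using assms(3) by auto
  show ?thesis
  proof (cases "R \<in> infinite_dyadic x")
    case True
    then show ?thesis using cell_subset_infinite assms(1) z by blast
  next
    case False
    then obtain j w where R: "R = cell x l j w" using assms by (auto simp: dyadic_def finite_dyadic_eq)
    show ?thesis
    proof (cases "j \<le> k")
      case True
      then show ?thesis using cell_nested[of z x l j w k y] z R by blast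
    next
      case False
      then show ?thesis using cell_nested[of z x l k y j w] z R by simp
    qed
  qed
qed

lemma cell_in_dyadic: "0 < l \<Longrightarrow> cell x l k y \<in> dyadic x l"
  by (auto simp: dyadic_def finite_dyadic_eq)

text \<open>Strict inclusion forces j < k, since otherwise the larger cell, taken around the same
  point y, would lie inside the smaller one. This keeps parents of stopping cubes inside the ambient
  cube.\<close>

lemma parent_subset:
  assumes "0 < l" "cell x l j y \<subset> cell x l k w"
  shows "cell x l (j + 1) y \<subseteq> cell x l k w"
proof -
  have y: "y \<in> cell x l k w" using assms(2) cell_refl by (rule psubsetD)
  then have e: "cell x l k w = cell x l k y" by (simp add: cell_eq)
  have "j < k"
  proof (rule ccontr)
    assume "\<not> j < k"
    then have "cell x l k y \<subseteq> cell x l j y" by (intro cell_mono) simp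
    then show False using assms e by blast
  qed
  then show ?thesis using cell_mono[of "j+1" k] e by simp
qed

text \<open>All candidates above Q are cells around one point y, so only the levels between that of
  Q and that of the ambient cube matter. A candidate written with a level outside this range
  coincides with Q or with the ambient cube; hence there are finitely many.\<close>

lemma ex_maximal_cell:
  assumes "0 < l" and "\<A> \<subseteq> finite_dyadic x l" "\<And>A. A \<in> \<A> \<Longrightarrow> A \<subseteq> cell x l k w" and "Q \<in> \<A>"
  obtains S where "S \<in> \<A>" "Q \<subseteq> S" "\<And>T. T \<in> \<A> \<Longrightarrow> S \<subseteq> T \<Longrightarrow> S = T"
proof -
  obtain j y where Q: "Q = cell x l j y" using assms by (auto simp: finite_dyadic_eq)
  have yk: "cell x l k w = cell x l k y"
    using assms(3)[OF assms(4)] Q by (metis cell_eq cell_refl subsetD)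
  have "{A \<in> \<A>. Q \<subseteq> A} \<subseteq> (\<lambda>i. cell x l i y) ` {j..k} \<union> {Q, cell x l k w}"
  proof
    fix A assume A: "A \<in> {A \<in> \<A>. Q \<subseteq> A}"
    then obtain i v where "A = cell x l i v" using assms by (auto simp: finite_dyadic_eq)
    moreover have "y \<in> A" using A Q by auto
    ultimately have Ai: "A = cell x l i y" by (simp add: cell_eq)
    have Ak: "A \<subseteq> cell x l k w" using A assms(3) by auto
    consider "i < j" | "i \<in> {j..k}" | "k < i" by fastforce
    then show "A \<in> (\<lambda>i. cell x l i y) ` {j..k} \<union> {Q, cell x l k w}"
    proof cases
      case 1
      then have "A \<subseteq> Q" using cell_mono[of i j x l y] Ai Q by simp
      then show ?thesis using A by auto
    next
      case 3
      then have "cell x l k w \<subseteq> A" using cell_mono[of k i x l y] Ai yk by simp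
      then show ?thesis using Ak by auto
    qed (use Ai in auto)
  qed
  then have "finite {A \<in> \<A>. Q \<subseteq> A}" by (rule finite_subset) simp
  moreover have "Q \<in> {A \<in> \<A>. Q \<subseteq> A}" using assms by auto
  ultimately obtain S where "S \<in> {A \<in> \<A>. Q \<subseteq> A}" "\<forall>T\<in>{A \<in> \<A>. Q \<subseteq> A}. S \<subseteq> T \<longrightarrow> S = T"
    using finite_has_maximal[of "{A \<in> \<A>. Q \<subseteq> A}"] by auto
  then show thesis using that[of S] by blast
qed

section \<open>The dyadic content\<close>

lemma content_le_cover:
  assumes "countable \<C>" "\<C> \<subseteq> dyadic x l" "E \<subseteq> \<Union>\<C>"
  shows "dyadic_content \<phi> x l E \<le> (\<Sum>\<^sub>\<infinity>R\<in>\<C>. \<phi> (side_length R))"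
  unfolding dyadic_content_def using assms by (intro Inf_lower) blast

lemma content_cover_less:
  assumes "dyadic_content \<phi> x l E < a"
  obtains \<C> where "countable \<C>" "\<C> \<subseteq> dyadic x l" "E \<subseteq> \<Union>\<C>" "(\<Sum>\<^sub>\<infinity>R\<in>\<C>. \<phi> (side_length R)) < a"
  using assms unfolding dyadic_content_def Inf_less_iff by blast

lemma content_greatest:
  assumes "\<And>\<C>. countable \<C> \<Longrightarrow> \<C> \<subseteq> dyadic x l \<Longrightarrow> E \<subseteq> \<Union>\<C> \<Longrightarrow> a \<le> (\<Sum>\<^sub>\<infinity>R\<in>\<C>. \<phi> (side_length R))"
  shows "a \<le> dyadic_content \<phi> x l E"
  unfolding dyadic_content_def using assms by (intro Inf_greatest) auto

lemma content_mono: "E \<subseteq> F \<Longrightarrow> dyadic_content \<phi> x l E \<le> dyadic_content \<phi> x l F"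
  by (rule content_greatest, rule content_le_cover) blast+

lemma content_le_single: "R \<in> dyadic x l \<Longrightarrow> E \<subseteq> R \<Longrightarrow> dyadic_content \<phi> x l E \<le> \<phi> (side_length R)"
  using content_le_cover[of "{R}" x l E \<phi>] by simp

lemma content_empty [simp]: "dyadic_content \<phi> x l {} = 0"
  using content_le_cover[of "{}" x l "{}" \<phi>] by simp

lemma content_UN_le:
  "dyadic_content \<phi> x l (\<Union>i::nat. E i) \<le> (\<Sum>i. dyadic_content \<phi> x l (E i))"
proof (cases "(\<Sum>i. dyadic_content \<phi> x l (E i)) = top")
  case False
  have fin: "dyadic_content \<phi> x l (E i) < top" for i
  proof -
    have "dyadic_content \<phi> x l (E i) = (\<Sum>j\<in>{i}. dyadic_content \<phi> x l (E j))" by simp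
    also have "\<dots> \<le> (\<Sum>i. dyadic_content \<phi> x l (E i))" by (rule sum_le_suminf) auto
    finally show ?thesis using False by (simp add: less_top le_less_trans)
  qed
  show ?thesis
  proof (rule ennreal_le_epsilon)
    fix e :: real assume e: "0 < e"
    have "\<exists>\<C>. countable \<C> \<and> \<C> \<subseteq> dyadic x l \<and> E i \<subseteq> \<Union>\<C> \<and>
      (\<Sum>\<^sub>\<infinity>R\<in>\<C>. \<phi> (side_length R)) \<le> dyadic_content \<phi> x l (E i) + ennreal (e * (1/2) ^ Suc i)" for i
    proof -
      have "dyadic_content \<phi> x l (E i) < dyadic_content \<phi> x l (E i) + ennreal (e * (1/2) ^ Suc i)"
        using fin[of i] e ennreal_add_left_cancel_less[of "dyadic_content \<phi> x l (E i)" 0 "ennreal (e * (1/2) ^ Suc i)"] by simp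
      from content_cover_less[OF this] show ?thesis by (metis less_imp_le)
    qed
    then obtain C where C: "\<And>i. countable (C i)" "\<And>i. C i \<subseteq> dyadic x l" "\<And>i. E i \<subseteq> \<Union>(C i)"
      "\<And>i. (\<Sum>\<^sub>\<infinity>R\<in>C i. \<phi> (side_length R)) \<le> dyadic_content \<phi> x l (E i) + ennreal (e * (1/2) ^ Suc i)"
      by metis
    have "dyadic_content \<phi> x l (\<Union>i. E i) \<le> (\<Sum>\<^sub>\<infinity>R\<in>(\<Union>i. C i). \<phi> (side_length R))"
    proof (rule content_le_cover)
      show "countable (\<Union>i. C i)" using C(1) by simp
      show "(\<Union>i. C i) \<subseteq> dyadic x l" using C(2) by blast
      show "(\<Union>i. E i) \<subseteq> \<Union> (\<Union>i. C i)" using C(3) by blast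
    qed
    also have "\<dots> \<le> (\<Sum>i. \<Sum>\<^sub>\<infinity>R\<in>C i. \<phi> (side_length R))"
      using C(1) by (rule infsum_ennreal_UN_le)
    also have "\<dots> \<le> (\<Sum>i. dyadic_content \<phi> x l (E i) + ennreal (e * (1/2) ^ Suc i))"
      using C(4) by (intro suminf_le) auto
    also have "\<dots> = (\<Sum>i. dyadic_content \<phi> x l (E i)) + (\<Sum>i. ennreal (e * (1/2) ^ Suc i))"
      by (rule suminf_add[symmetric]) auto
    also have "(\<Sum>i. ennreal (e * (1/2) ^ Suc i)) = ennreal e"
      using e sums_mult[OF power_half_series, of e] by (subst suminf_ennreal_eq) auto
    finally show "dyadic_content \<phi> x l (\<Union>i. E i) \<le> (\<Sum>i. dyadic_content \<phi> x l (E i)) + ennreal e" .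
  qed
qed simp

lemma content_Union_le:
  fixes \<S> :: "'b set"
  assumes "countable \<S>"
  shows "dyadic_content \<phi> x l (\<Union>S\<in>\<S>. E S) \<le> (\<Sum>\<^sub>\<infinity>S\<in>\<S>. dyadic_content \<phi> x l (E S))"
proof -
  obtain g :: "'b \<Rightarrow> nat" where g: "inj_on g \<S>" using assms by (auto simp: countable_def)
  define F where "F n = (if n \<in> g ` \<S> then E (the_inv_into \<S> g n) else {})" for n
  have Fg: "F (g S) = E S" if "S \<in> \<S>" for S using that g by (simp add: F_def the_inv_into_f_f)
  have "(\<Union>S\<in>\<S>. E S) \<subseteq> (\<Union>n. F n)" using Fg by blast
  then have "dyadic_content \<phi> x l (\<Union>S\<in>\<S>. E S) \<le> (\<Sum>n. dyadic_content \<phi> x l (F n))"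
    by (rule order_trans[OF content_mono content_UN_le])
  also have "\<dots> = (\<integral>\<^sup>+n. dyadic_content \<phi> x l (F n) \<partial>count_space UNIV)"
    by (rule nn_integral_count_space_nat[symmetric])
  also have "\<dots> = (\<integral>\<^sup>+n. dyadic_content \<phi> x l (F n) \<partial>count_space (g ` \<S>))"
    by (rule nn_integral_count_space_eq) (auto simp: F_def)
  also have "\<dots> = (\<integral>\<^sup>+S. dyadic_content \<phi> x l (F (g S)) \<partial>count_space \<S>)"
    using g by (intro nn_integral_bij_count_space[symmetric]) (simp add: bij_betw_def)
  also have "\<dots> = (\<integral>\<^sup>+S. dyadic_content \<phi> x l (E S) \<partial>count_space \<S>)"
    by (intro nn_integral_cong) (simp add: Fg)
  also have "\<dots> = (\<Sum>\<^sub>\<infinity>S\<in>\<S>. dyadic_content \<phi> x l (E S))"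
    using assms by (rule infsum_ennreal_eq_nn_integral[symmetric])
  finally show ?thesis .
qed

lemma content_Un_le:
  "dyadic_content \<phi> x l (E \<union> F) \<le> dyadic_content \<phi> x l E + dyadic_content \<phi> x l F"
proof -
  have "dyadic_content \<phi> x l (\<Union>b\<in>{True, False}. if b then E else F)
    \<le> (\<Sum>\<^sub>\<infinity>b\<in>{True, False}. dyadic_content \<phi> x l (if b then E else F))"
    by (rule content_Union_le) simp
  then show ?thesis by (simp add: ac_simps)
qed

section \<open>Translation invariance, doubling and finiteness of the content of cubes\<close>

definition cell_shift :: "real \<Rightarrow> int \<Rightarrow> int ^ 'n \<Rightarrow> real ^ 'n" where
  "cell_shift l k m = (\<chi> i. 2 powi k * l * of_int (m $ i))"

text \<open>A multiple of a coarse side is an integer multiple of every finer side, so vectors of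
  the level-k lattice permute the cells of each level j <= k.\<close>

lemma floor_shift:
  fixes r :: real
  assumes "0 < l" "j \<le> k"
  shows "\<lfloor>(r + 2 powi k * l * of_int m) / (2 powi j * l)\<rfloor> = \<lfloor>r / (2 powi j * l)\<rfloor> + 2 ^ nat (k - j) * m"
proof -
  have "(2::real) powi k = 2 powi j * 2 powi (k - j)" by (simp flip: power_int_add)
  also have "(2::real) powi (k - j) = of_int (2 ^ nat (k - j))" using assms by (simp add: power_int_def)
  finally have "(r + 2 powi k * l * of_int m) / (2 powi j * l) = r / (2 powi j * l) + of_int (2 ^ nat (k - j) * m)"
    using assms by (simp add: field_simps)
  then show ?thesis by (simp only: floor_add_int)
qed

lemma cell_translate:
  assumes "0 < l" "j \<le> k"
  shows "(\<lambda>z. z + cell_shift l k m) ` cell x l j y = cell x l j (y + cell_shift l k m)"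
proof -
  have *: "z + cell_shift l k m \<in> cell x l j (y + cell_shift l k m) \<longleftrightarrow> z \<in> cell x l j y" for z y m
    using floor_shift[OF assms, of "z $ i - x $ i" "m $ i" for i] floor_shift[OF assms, of "y $ i - x $ i" "m $ i" for i]
    by (simp add: cell_def cell_shift_def algebra_simps)
  show ?thesis
  proof (intro subset_antisym subsetI)
    fix z assume "z \<in> cell x l j (y + cell_shift l k m)"
    then have "z - cell_shift l k m \<in> cell x l j y" using *[of "z - cell_shift l k m" m y] by simp
    then show "z \<in> (\<lambda>z. z + cell_shift l k m) ` cell x l j y" by (rule rev_image_eqI) simp
  qed (auto simp: *)
qed

lemma cell_translate_to:
  assumes "0 < l"
  shows "cell x l k y' = cell x l k (y + cell_shift l k (\<chi> i. \<lfloor>(y' $ i - x $ i) / (2 powi k * l)\<rfloor> - \<lfloor>(y $ i - x $ i) / (2 powi k * l)\<rfloor>))"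
proof -
  define p where "p = (\<chi> i. \<lfloor>(y' $ i - x $ i) / (2 powi k * l)\<rfloor> - \<lfloor>(y $ i - x $ i) / (2 powi k * l)\<rfloor>)"
  have "\<lfloor>((y + cell_shift l k p) $ i - x $ i) / (2 powi k * l)\<rfloor> = \<lfloor>(y' $ i - x $ i) / (2 powi k * l)\<rfloor>" for i
  proof -
    have e: "(y + cell_shift l k p) $ i - x $ i = (y $ i - x $ i) + 2 powi k * l * of_int (p $ i)"
      by (simp add: cell_shift_def)
    have "\<lfloor>((y + cell_shift l k p) $ i - x $ i) / (2 powi k * l)\<rfloor> = \<lfloor>(y $ i - x $ i) / (2 powi k * l)\<rfloor> + p $ i"
      unfolding e using floor_shift[OF assms order.refl, of "y $ i - x $ i" k "p $ i"] by simp
    then show ?thesis by (simp add: p_def)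
  qed
  then have "y + cell_shift l k p \<in> cell x l k y'" by (simp add: cell_def)
  then show ?thesis by (simp add: cell_eq p_def)
qed

text \<open>A cover containing a cube around \<open>cell x l k y\<close> costs at least as much as the shifted cube itself;
  otherwise its relevant members are small enough for the shift to respect the grid.\<close>

lemma content_cell_le_shift:
  assumes "0 < l" "mono \<phi>"
  shows "dyadic_content \<phi> x l (cell x l k (y + cell_shift l k m)) \<le> dyadic_content \<phi> x l (cell x l k y)"
proof (rule content_greatest)
  fix \<C> assume C: "countable \<C>" "\<C> \<subseteq> dyadic x l" "cell x l k y \<subseteq> \<Union>\<C>"
  let ?v = "cell_shift l k m" and ?S = "cell x l k (y + cell_shift l k m)"
  show "dyadic_content \<phi> x l ?S \<le> (\<Sum>\<^sub>\<infinity>R\<in>\<C>. \<phi> (side_length R))"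
  proof (cases "\<exists>R\<in>\<C>. cell x l k y \<subseteq> R")
    case True
    then obtain R where R: "R \<in> \<C>" "cell x l k y \<subseteq> R" by auto
    have "side_length (cell x l k y) \<le> side_length R"
    proof (cases "R \<in> infinite_dyadic x")
      case False
      then obtain j w where R': "R = cell x l j w" using R C by (auto simp: dyadic_def finite_dyadic_eq[OF assms(1)])
      have "k \<le> j \<or> R = cell x l k y"
      proof (rule disjCI)
        assume "R \<noteq> cell x l k y"
        show "k \<le> j"
        proof (rule ccontr)
          assume "\<not> k \<le> j"
          moreover have "y \<in> cell x l j w" using R R' cell_refl by blast
          ultimately have "R \<subseteq> cell x l k y" using cell_nested[of y x l j w k y] R' by simp
          then show False using R \<open>R \<noteq> cell x l k y\<close> by auto
        qed
      qed
      then show ?thesis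
      proof
        assume "k \<le> j"
        then have "2 powi k * l \<le> 2 powi j * l"
          using assms(1) by (intro mult_right_mono power_int_increasing) auto
        then show ?thesis unfolding R' side_length_cell[OF assms(1)] by (rule ennreal_leI)
      qed simp
    qed (simp add: side_length_infinite_dyadic)
    then have "\<phi> (ennreal (2 powi k * l)) \<le> \<phi> (side_length R)"
      using assms by (simp add: side_length_cell monoD)
    then have "dyadic_content \<phi> x l ?S \<le> \<phi> (side_length R)"
      using content_le_single[OF cell_in_dyadic[OF assms(1)] order.refl, of \<phi> x k "y + ?v"] assms(1)
      by (simp add: side_length_cell)
    also have "\<dots> \<le> (\<Sum>\<^sub>\<infinity>R\<in>\<C>. \<phi> (side_length R))"
      using infsum_ennreal_mono_set[of "{R}" \<C> "\<lambda>R. \<phi> (side_length R)"] R(1) by simp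
    finally show ?thesis .
  next
    case False
    define \<D> where "\<D> = {R\<in>\<C>. R \<inter> cell x l k y \<noteq> {}}"
    have D: "\<exists>j w. j \<le> k \<and> R = cell x l j w" if "R \<in> \<D>" for R
      using dyadic_meets_cell[OF assms(1), of R x k y] that C False by (auto simp: \<D>_def)
    have shift: "(\<lambda>z. z + ?v) ` R \<in> dyadic x l \<and> side_length ((\<lambda>z. z + ?v) ` R) = side_length R" if "R \<in> \<D>" for R
    proof -
      obtain j w where R: "j \<le> k" "R = cell x l j w" using D[OF \<open>R \<in> \<D>\<close>] by blast
      then have "(\<lambda>z. z + ?v) ` R = cell x l j (w + ?v)" using cell_translate[OF assms(1)] by blast
      then show ?thesis using R(2) assms(1) by (simp add: cell_in_dyadic side_length_cell)
    qed
    have "dyadic_content \<phi> x l ?S \<le> (\<Sum>\<^sub>\<infinity>R\<in>(`) (\<lambda>z. z + ?v) ` \<D>. \<phi> (side_length R))"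
    proof (rule content_le_cover)
      show "countable ((`) (\<lambda>z. z + ?v) ` \<D>)" using C by (simp add: \<D>_def)
      show "(`) (\<lambda>z. z + ?v) ` \<D> \<subseteq> dyadic x l" using shift by auto
      have "cell x l k y \<subseteq> \<Union>\<D>" using C(3) by (fastforce simp: \<D>_def)
      then have "(\<lambda>z. z + ?v) ` cell x l k y \<subseteq> (\<lambda>z. z + ?v) ` \<Union>\<D>" by (rule image_mono)
      then show "?S \<subseteq> \<Union> ((`) (\<lambda>z. z + ?v) ` \<D>)"
        unfolding cell_translate[OF assms(1) order.refl] by blast
    qed
    also have "\<dots> = (\<Sum>\<^sub>\<infinity>R\<in>\<D>. \<phi> (side_length ((\<lambda>z. z + ?v) ` R)))"
      by (subst infsum_reindex) (auto simp: o_def inj_on_def inj_image_eq_iff)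
    also have "\<dots> = (\<Sum>\<^sub>\<infinity>R\<in>\<D>. \<phi> (side_length R))"
      using shift by (intro infsum_cong) simp
    also have "\<dots> \<le> (\<Sum>\<^sub>\<infinity>R\<in>\<C>. \<phi> (side_length R))"
      by (rule infsum_ennreal_mono_set) (auto simp: \<D>_def)
    finally show ?thesis .
  qed
qed

lemma content_cell_eq:
  assumes "0 < l" "mono \<phi>"
  shows "dyadic_content \<phi> x l (cell x l k y) = dyadic_content \<phi> x l (cell x l k y')"
proof -
  have "dyadic_content \<phi> x l (cell x l k z) \<le> dyadic_content \<phi> x l (cell x l k w)" for z w
    by (subst cell_translate_to[OF assms(1), of x k z w]) (rule content_cell_le_shift[OF assms])
  then show ?thesis by (intro antisym)
qed

text \<open>The parent splits into pieces \<open>K S\<close>, where S is the set of coordinates with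
  odd index at level k. Each nonempty piece lies in one cell of level k, all of these have equal
  content, and there are 2 ^ CARD('n) sets S. Subadditivity does the rest, with no growth condition
  on \<phi>.\<close>

lemma content_cell_Suc_le:
  fixes x :: "real ^ 'n"
  assumes "0 < l" "mono \<phi>"
  shows "dyadic_content \<phi> x l (cell x l (k + 1) y) \<le> 2 ^ CARD('n) * dyadic_content \<phi> x l (cell x l k y')"
proof -
  define K where "K S = {w \<in> cell x l (k + 1) y. \<forall>i. \<lfloor>(w $ i - x $ i) / (2 powi k * l)\<rfloor>
    = 2 * \<lfloor>(y $ i - x $ i) / (2 powi (k + 1) * l)\<rfloor> + (if i \<in> S then 1 else 0)}" for S
  have KS: "dyadic_content \<phi> x l (K S) \<le> dyadic_content \<phi> x l (cell x l k y')" for S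
  proof (cases "K S = {}")
    case False
    then obtain w where w: "w \<in> K S" by auto
    then have "K S \<subseteq> cell x l k w" by (auto simp: K_def cell_def)
    then show ?thesis using content_cell_eq[OF assms, of x k w y'] content_mono[of "K S" "cell x l k w" \<phi> x l] by simp
  qed simp
  have "cell x l (k + 1) y \<subseteq> (\<Union>S\<in>UNIV. K S)"
  proof
    fix w assume w: "w \<in> cell x l (k + 1) y"
    have "w \<in> K {i. odd \<lfloor>(w $ i - x $ i) / (2 powi k * l)\<rfloor>}"
    proof -
      have "\<lfloor>(w $ i - x $ i) / (2 powi k * l)\<rfloor> = 2 * \<lfloor>(y $ i - x $ i) / (2 powi (k + 1) * l)\<rfloor>
        + (if odd \<lfloor>(w $ i - x $ i) / (2 powi k * l)\<rfloor> then 1 else 0)" for i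
      proof -
        have "\<lfloor>(y $ i - x $ i) / (2 powi (k + 1) * l)\<rfloor> = \<lfloor>(w $ i - x $ i) / (2 powi k * l)\<rfloor> div 2"
          using w by (simp add: cell_def flip: index_Suc)
        then show ?thesis by presburger
      qed
      then show ?thesis using w unfolding K_def mem_Collect_eq by blast
    qed
    then show "w \<in> (\<Union>S\<in>UNIV. K S)" by blast
  qed
  then have "dyadic_content \<phi> x l (cell x l (k + 1) y) \<le> dyadic_content \<phi> x l (\<Union>S\<in>UNIV. K S)" by (rule content_mono)
  also have "\<dots> \<le> (\<Sum>\<^sub>\<infinity>S\<in>UNIV. dyadic_content \<phi> x l (K S))"
    by (rule content_Union_le) (simp add: countable_finite)
  also have "\<dots> = (\<Sum>S\<in>UNIV. dyadic_content \<phi> x l (K S))" by simp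
  also have "\<dots> \<le> (\<Sum>S\<in>(UNIV :: 'n set set). dyadic_content \<phi> x l (cell x l k y'))" by (rule sum_mono) (rule KS)
  also have "\<dots> = 2 ^ CARD('n) * dyadic_content \<phi> x l (cell x l k y')"
    by (simp add: card_UNIV_set)
  finally show ?thesis .
qed

text \<open>As \<phi> may be infinite at the side of the cube itself, finiteness starts from a cube
  so small that \<phi> is below 1 there, and climbs by doubling.\<close>

lemma content_cell_less_top:
  fixes x :: "real ^ 'n"
  assumes "0 < l" "mono \<phi>" "(\<phi> \<longlongrightarrow> 0) (at_right 0)"
  shows "dyadic_content \<phi> x l (cell x l k y) < top"
proof -
  have "\<forall>\<^sub>F t in at_right 0. \<phi> t < 1" using assms(3) by (rule order_tendstoD) simp
  then obtain b where b: "0 < b" "\<And>t. 0 < t \<Longrightarrow> t < b \<Longrightarrow> \<phi> t < 1"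
    using eventually_at_right[of 0 top "\<lambda>t. \<phi> t < 1"] by auto
  obtain r' where r': "0 < r'" "r' < b" using b(1) dense by blast
  then have "r' \<noteq> top" by (metis not_less top_greatest)
  then obtain r where "r' = ennreal r" "0 \<le> r" using ennreal_cases by blast
  then have r: "0 < r" "ennreal r < b" using r' by auto
  obtain n where n: "(1/2 :: real) ^ n < r / l" using real_arch_pow_inv[of "r / l" "1/2"] r assms by auto
  have "\<phi> (ennreal (2 powi (- int n) * l)) < 1"
  proof (rule b(2))
    have "2 powi (- int n) * l < r" using n assms(1) by (simp add: power_int_minus field_simps)
    then show "ennreal (2 powi (- int n) * l) < b" using r using ennreal_lessI less_trans by blast
  qed (use assms in simp)
  then have base: "dyadic_content \<phi> x l (cell x l (- int n) y) < top" for y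
    using content_le_single[OF cell_in_dyadic[OF assms(1)] order.refl, of \<phi> x "- int n" y] assms(1)
    by (simp add: side_length_cell) (meson ennreal_one_less_top le_less_trans less_trans)
  show ?thesis
  proof (cases "- int n \<le> k")
    case True
    then show ?thesis
    proof (induction k rule: int_ge_induct)
      case (step i)
      have "dyadic_content \<phi> x l (cell x l (i + 1) y) \<le> 2 ^ CARD('n) * dyadic_content \<phi> x l (cell x l i y)"
        by (rule content_cell_Suc_le[OF assms(1,2)])
      also have "\<dots> < top" using step.IH by (simp add: ennreal_mult_less_top power_less_top_ennreal)
      finally show ?case .
    qed (rule base)
  next
    case False
    then have "cell x l k y \<subseteq> cell x l (- int n) y" by (intro cell_mono) simp
    then show ?thesis using content_mono base le_less_trans by blast
  qed
qed

section \<open>Choquet integrals and oscillation\<close>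

lemma superlevel_measurable:
  fixes H :: "'a set \<Rightarrow> ennreal"
  assumes "\<And>E F. E \<subseteq> F \<Longrightarrow> H E \<le> H F"
  shows "(\<lambda>t::real. H {y \<in> A. t < g y}) \<in> borel_measurable borel"
  by (intro borel_measurable_antimono_ennreal antimonoI assms) auto

text \<open>For t in (0, s] the set {g > t} contains {g > s}, so the integrand is at least the
  constant H {g > s} there.\<close>

lemma choquet_chebyshev:
  assumes "\<And>E F. E \<subseteq> F \<Longrightarrow> H E \<le> H F" and "0 \<le> s"
  shows "ennreal s * H {y \<in> A. s < g y} \<le> choquet_integral H A g"
proof -
  have "ennreal s * H {y \<in> A. s < g y} = (\<integral>\<^sup>+t. H {y \<in> A. s < g y} * indicator {0<..s} t \<partial>lborel)"
    using assms(2) by (subst nn_integral_cmult_indicator) (simp_all add: mult.commute)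
  also have "\<dots> \<le> choquet_integral H A g"
    unfolding choquet_integral_def
    by (intro nn_integral_mono) (auto split: split_indicator intro!: assms(1))
  finally show ?thesis .
qed

text \<open>For a general monotone H the Choquet integral need not be subadditive, but adding a
  constant d merely translates the distribution function: levels above d reproduce the integral of
  h, and those up to d cost at most d * H A.\<close>

lemma choquet_integral_le_add:
  assumes H: "\<And>E F. E \<subseteq> F \<Longrightarrow> H E \<le> H F" and "0 \<le> d" and gh: "\<And>y. y \<in> A \<Longrightarrow> g y \<le> h y + d"
  shows "choquet_integral H A g \<le> choquet_integral H A h + ennreal d * H A"
proof -
  note [measurable] = superlevel_measurable[OF H]
  have "choquet_integral H A g
      \<le> (\<integral>\<^sup>+t. H {y \<in> A. t - d < h y} * indicator {0<..} (t - d) + H A * indicator {0<..d} t \<partial>lborel)"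
    unfolding choquet_integral_def
  proof (rule nn_integral_mono)
    fix t :: real
    have "{y \<in> A. t < g y} \<subseteq> {y \<in> A. t - d < h y}" using gh by force
    then have "H {y \<in> A. t < g y} \<le> H {y \<in> A. t - d < h y}" by (rule H)
    moreover have "H {y \<in> A. t < g y} \<le> H A" by (rule H) auto
    ultimately show "H {y \<in> A. t < g y} * indicator {0<..} t
      \<le> H {y \<in> A. t - d < h y} * indicator {0<..} (t - d) + H A * indicator {0<..d} t"
      by (auto split: split_indicator)
  qed
  also have "\<dots> = (\<integral>\<^sup>+t. H {y \<in> A. t - d < h y} * indicator {0<..} (t - d) \<partial>lborel)
      + (\<integral>\<^sup>+t. H A * indicator {0<..d} t \<partial>lborel)"
    by (rule nn_integral_add) measurable
  also have "(\<integral>\<^sup>+t. H A * indicator {0<..d} t \<partial>lborel) = ennreal d * H A"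
    using assms(2) by (simp add: nn_integral_cmult_indicator mult.commute)
  also have "(\<integral>\<^sup>+t. H {y \<in> A. t - d < h y} * indicator {0<..} (t - d) \<partial>lborel) = choquet_integral H A h"
    unfolding choquet_integral_def
    by (subst (2) nn_integral_real_affine[where c = 1 and t = "- d"]) (simp_all, measurable)
  finally show ?thesis .
qed

text \<open>At every level t < M each point of A has g > t or h > t, so subadditivity of H applies
  level by level. This is the source of coercivity in the search for a minimizer.\<close>

lemma choquet_integral_add_ge:
  assumes H: "\<And>E F. E \<subseteq> F \<Longrightarrow> H E \<le> H F" "\<And>E F. H (E \<union> F) \<le> H E + H F"
    and "0 \<le> M" and gh: "\<And>y. y \<in> A \<Longrightarrow> 2 * M \<le> g y + h y"
  shows "ennreal M * H A \<le> choquet_integral H A g + choquet_integral H A h"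
proof -
  note [measurable] = superlevel_measurable[OF H(1)]
  have "ennreal M * H A = (\<integral>\<^sup>+t. H A * indicator {0<..<M} t \<partial>lborel)"
    using assms(3) by (simp add: nn_integral_cmult_indicator mult.commute)
  also have "\<dots> \<le> (\<integral>\<^sup>+t. H {y \<in> A. t < g y} * indicator {0<..} t + H {y \<in> A. t < h y} * indicator {0<..} t \<partial>lborel)"
  proof (rule nn_integral_mono)
    fix t :: real
    show "H A * indicator {0<..<M} t
      \<le> H {y \<in> A. t < g y} * indicator {0<..} t + H {y \<in> A. t < h y} * indicator {0<..} t"
    proof (cases "t \<in> {0<..<M}")
      case True
      have "t < g y \<or> t < h y" if "y \<in> A" for y using gh[OF that] True by auto
      then have "A \<subseteq> {y \<in> A. t < g y} \<union> {y \<in> A. t < h y}" by auto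
      then have "H A \<le> H {y \<in> A. t < g y} + H {y \<in> A. t < h y}" using H order_trans by meson
      then show ?thesis using True by simp
    qed simp
  qed
  also have "\<dots> = choquet_integral H A g + choquet_integral H A h"
    unfolding choquet_integral_def by (rule nn_integral_add) measurable
  finally show ?thesis .
qed

text \<open>If H A = 0 or every integral is infinite, each constant is a minimizer. Otherwise c
  \<mapsto> I c is finite, Lipschitz with constant H A, and coercive, so it attains its minimum on a
  large enough compact interval.\<close>

lemma ex_choquet_average_minimizer:
  assumes H: "\<And>E F. E \<subseteq> F \<Longrightarrow> H E \<le> H F" "\<And>E F. H (E \<union> F) \<le> H E + H F" and fin: "H A < top"
  shows "\<exists>c1. \<forall>c. choquet_average H A (\<lambda>z. \<bar>f z - c1\<bar>) \<le> choquet_average H A (\<lambda>z. \<bar>f z - c\<bar>)"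
proof -
  define I where "I c = choquet_integral H A (\<lambda>z. \<bar>f z - c\<bar>)" for c
  have avg: "choquet_average H A (\<lambda>z. \<bar>f z - c\<bar>) = (if H A = 0 then 0 else 1 / H A * I c)" for c
    by (simp add: choquet_average_def I_def)
  consider "H A = 0" | "\<forall>c. I c = top" | c0 where "H A \<noteq> 0" "I c0 \<noteq> top" by blast
  then have "H A = 0 \<or> (\<exists>c1. \<forall>c. I c1 \<le> I c)"
  proof cases
    case 3
    have lip: "I c \<le> I d + ennreal \<bar>c - d\<bar> * H A" for c d
      unfolding I_def by (rule choquet_integral_le_add[OF H(1)]) auto
    obtain h where h: "H A = ennreal h" "0 < h"
      using 3(1) fin by (cases "H A" rule: ennreal_cases) (auto simp: ennreal_eq_0_iff not_le)
    have Ifin: "I c < top" for c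
    proof -
      have "I c0 + ennreal \<bar>c - c0\<bar> * H A < top"
        using 3(2) fin by (simp add: ennreal_mult_less_top less_top)
      then show ?thesis using lip[of c c0] by (rule le_less_trans[rotated])
    qed
    define u where "u c = enn2real (I c)" for c
    have Iu: "I c = ennreal (u c)" and u0: "0 \<le> u c" for c using Ifin[of c] by (auto simp: u_def)
    have ulip: "u c \<le> u d + \<bar>c - d\<bar> * h" for c d
    proof -
      have p: "0 \<le> \<bar>c - d\<bar> * h" using h(2) by simp
      have "ennreal (u c) \<le> ennreal (u d) + ennreal (\<bar>c - d\<bar> * h)"
        using lip[of c d] h(2) by (simp add: Iu h(1) ennreal_mult)
      also have "\<dots> = ennreal (u d + \<bar>c - d\<bar> * h)" by (rule ennreal_plus[OF u0 p, symmetric])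
      finally show ?thesis using u0[of d] p by (subst (asm) ennreal_le_iff) simp_all
    qed
    have "continuous_on UNIV u"
    proof (rule lipschitz_on_continuous_on)
      show "h-lipschitz_on UNIV u"
      proof (rule lipschitz_onI)
        fix c d
        show "dist (u c) (u d) \<le> h * dist c d"
          using ulip[of c d] ulip[of d c] by (simp add: dist_real_def abs_le_iff abs_minus_commute mult.commute)
      qed (use h in simp)
    qed
    \<comment> \<open>Coercivity reads \<bar>c - c0\<bar> / 2 * h <= u c + u c0. The radius makes
      the left side at least 2 * u c0 outside the interval, which gives u c >= u c0 there.\<close>
    define r where "r = 4 * u c0 / h"
    have r0: "0 \<le> r" using u0 h(2) by (simp add: r_def)
    have "\<exists>c1\<in>{c0 - r..c0 + r}. \<forall>c\<in>{c0 - r..c0 + r}. u c1 \<le> u c"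
      using r0 by (intro continuous_attains_inf continuous_on_subset[OF \<open>continuous_on UNIV u\<close>]) auto
    then obtain c1 where c1: "\<And>c. c \<in> {c0 - r..c0 + r} \<Longrightarrow> u c1 \<le> u c" by blast
    have "u c1 \<le> u c" for c
    proof (cases "c \<in> {c0 - r..c0 + r}")
      case False
      have "ennreal (\<bar>c - c0\<bar> / 2) * H A \<le> I c + I c0"
        unfolding I_def by (rule choquet_integral_add_ge[OF H]) auto
      then have "ennreal (\<bar>c - c0\<bar> / 2 * h) \<le> ennreal (u c + u c0)"
        using h(2) u0 by (simp add: Iu h(1) flip: ennreal_mult)
      then have "\<bar>c - c0\<bar> / 2 * h \<le> u c + u c0"
        using u0[of c] u0[of c0] by (subst (asm) ennreal_le_iff) simp_all
      moreover have "r / 2 * h \<le> \<bar>c - c0\<bar> / 2 * h" using False h(2) by (intro mult_right_mono) auto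
      moreover have "r / 2 * h = 2 * u c0" using h(2) by (simp add: r_def)
      moreover have "u c1 \<le> u c0" using c1 r0 by simp
      ultimately show ?thesis by linarith
    qed (rule c1)
    then show ?thesis using u0 by (auto simp: Iu intro!: exI[of _ c1] ennreal_leI)
  qed auto
  then show ?thesis by (metis avg mult_left_mono order.refl zero_le)
qed

lemma oscillation_minimizer_iff:
  "is_oscillation_minimizer \<phi> x l Q' f c \<longleftrightarrow>
    (\<forall>d. choquet_average (dyadic_content \<phi> x l) Q' (\<lambda>z. \<bar>f z - c\<bar>)
      \<le> choquet_average (dyadic_content \<phi> x l) Q' (\<lambda>z. \<bar>f z - d\<bar>))"
  by (auto simp: is_oscillation_minimizer_def is_arg_min_def not_less)

section \<open>From the essential supremum to a bound on every single cube\<close>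

lemma dyadic_borel:
  assumes "R \<in> dyadic x l"
  shows "R \<in> sets borel"
proof -
  have *: "{y :: real ^ 'a. \<forall>i. y $ i \<in> I i} \<in> sets borel" if [measurable]: "\<And>i. I i \<in> sets borel" for I
    by measurable
  consider a s where "R = hcube a s" | "R \<in> infinite_dyadic x"
    using assms by (auto simp: dyadic_def finite_dyadic_def)
  then show ?thesis
  proof cases
    case 1
    then have "R = {y. \<forall>i. y $ i \<in> {a $ i..<a $ i + s}}" by (auto simp: hcube_def)
    then show ?thesis using * by simp
  next
    case 2
    then obtain I where R: "R = {y. \<forall>i. y $ i \<in> I i}" and I: "\<And>i. I i = {x $ i..} \<or> I i = {..<x $ i}"
      unfolding infinite_dyadic_def by blast
    have "I i \<in> sets borel" for i using I[of i] by (rule disjE) simp_all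
    then show ?thesis unfolding R by (rule *)
  qed
qed

text \<open>A cell contains a nonempty open box, hence is not negligible and cannot consist of
  exceptional points only.\<close>

lemma AE_cell_obtains:
  assumes "0 < l" "Q0 \<in> dyadic x l" "cell x l k y \<subseteq> Q0" "AE z in lebesgue_on Q0. P z"
  obtains z where "z \<in> cell x l k y" "P z"
proof -
  have Q0: "Q0 \<in> sets lebesgue" using dyadic_borel[OF assms(2)] by simp
  then have "AE z in lebesgue. z \<in> Q0 \<longrightarrow> P z"
    using assms(4) by (subst (asm) AE_restrict_space_iff) auto
  then obtain N where N: "{z \<in> space lebesgue. \<not> (z \<in> Q0 \<longrightarrow> P z)} \<subseteq> N"
    and "emeasure lebesgue N = 0" "N \<in> sets lebesgue"
    by (rule AE_E)
  then have "negligible N" by (simp add: negligible_iff_null_sets null_setsI)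
  then have neg: "negligible {z. \<not> (z \<in> Q0 \<longrightarrow> P z)}" using N by (auto intro: negligible_subset)
  define s where "s = 2 powi k * l"
  obtain a where a: "cell x l k y = hcube a s" using cell_eq_hcube[OF assms(1)] s_def by blast
  let ?b = "a + s *\<^sub>R (\<chi> i. 1)"
  have "box a ?b \<subseteq> cell x l k y" unfolding a hcube_def by (auto simp: mem_box_cart intro: less_imp_le)
  moreover have "a + (s / 2) *\<^sub>R (\<chi> i. 1) \<in> box a ?b"
    using assms(1) by (simp add: mem_box_cart s_def)
  ultimately have "\<not> negligible (cell x l k y)"
    using open_not_negligible[OF open_box, of a ?b] negligible_subset by blast
  then have "\<not> cell x l k y \<subseteq> {z. \<not> (z \<in> Q0 \<longrightarrow> P z)}" using neg negligible_subset by blast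
  then show thesis using that assms(3) by blast
qed

text \<open>One point z of the cube at which the maximal function is at most the norm suffices: the
  supremum defining it at z includes this very cube.\<close>

lemma oscillation_le_BMO_norm:
  assumes "0 < l" "mono \<phi>" "(\<phi> \<longlongrightarrow> 0) (at_right 0)" "Q0 \<in> dyadic x l" "cell x l k y \<subseteq> Q0"
    and "is_oscillation_minimizer \<phi> x l (cell x l k y) f c"
  shows "choquet_integral (dyadic_content \<phi> x l) (cell x l k y) (\<lambda>z. \<bar>f z - c\<bar>)
    \<le> BMO_norm \<phi> x l Q0 f * dyadic_content \<phi> x l (cell x l k y)"
proof -
  let ?Q = "cell x l k y" and ?H = "dyadic_content \<phi> x l"
  let ?I = "choquet_integral ?H ?Q (\<lambda>z. \<bar>f z - c\<bar>)"
  obtain z where z: "z \<in> ?Q" "sharp_maximal \<phi> x l Q0 f z \<le> BMO_norm \<phi> x l Q0 f"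
    using AE_cell_obtains[OF assms(1,4,5) esssup_AE] unfolding BMO_norm_def by blast
  have "choquet_average ?H ?Q (\<lambda>z. \<bar>f z - c\<bar>) \<le> (INF d. choquet_average ?H ?Q (\<lambda>z. \<bar>f z - d\<bar>))"
    using assms(6) by (intro INF_greatest) (simp add: oscillation_minimizer_iff)
  also have "\<dots> \<le> sharp_maximal \<phi> x l Q0 f z"
    unfolding sharp_maximal_def using z(1) assms(5) cell_in_dyadic[OF assms(1)] by (intro SUP_upper) blast
  also note z(2)
  finally have avg: "choquet_average ?H ?Q (\<lambda>z. \<bar>f z - c\<bar>) \<le> BMO_norm \<phi> x l Q0 f" .
  show ?thesis
  proof (cases "?H ?Q = 0")
    case True
    have "?H {z \<in> ?Q. t < \<bar>f z - c\<bar>} = 0" for t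
      using content_mono[of "{z \<in> ?Q. t < \<bar>f z - c\<bar>}" ?Q \<phi> x l] True by auto
    then have "?I = 0" by (simp add: choquet_integral_def)
    then show ?thesis by simp
  next
    case False
    have fin: "?H ?Q < top" by (rule content_cell_less_top[OF assms(1-3)])
    have "?H ?Q * (1 / ?H ?Q) = 1" using False fin by (simp add: ennreal_times_divide)
    then have "?I = ?I * (?H ?Q * (1 / ?H ?Q))" by simp
    also have "\<dots> = (1 / ?H ?Q * ?I) * ?H ?Q" by (simp only: ac_simps)
    also have "\<dots> \<le> BMO_norm \<phi> x l Q0 f * ?H ?Q"
      using avg False by (intro mult_right_mono) (auto simp: choquet_average_def)
    finally show ?thesis .
  qed
qed

section \<open>Stopping cubes and exponential decay\<close>

lemma ennreal_add_less_of_halves: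
  fixes a b h :: ennreal
  assumes "2 * a < h" "2 * b \<le> h" "h < top"
  shows "a + b < h"
proof (rule ccontr)
  assume "\<not> a + b < h"
  then have "2 * h \<le> 2 * (a + b)" by (intro mult_left_mono) auto
  then have "h + h \<le> 2 * b + 2 * a" by (simp add: distrib_left add.commute flip: mult_2)
  also have "\<dots> \<le> h + 2 * a" using assms(2) by (rule add_right_mono)
  finally have "h \<le> 2 * a" using assms(3) by (auto simp: ennreal_add_left_cancel_le)
  then show False using assms(1) by simp
qed

text \<open>If a and b were more than 2 s apart, no value of f could be within s of both, and the
  two exceptional sets would cover R. This replaces averaging \<bar>a - b\<bar> over R.\<close>

lemma abs_diff_le_of_small_superlevels:
  fixes f :: "real ^ 'n \<Rightarrow> real"
  assumes "dyadic_content \<phi> x l {y \<in> R. s < \<bar>f y - a\<bar>} + dyadic_content \<phi> x l {y \<in> R. s < \<bar>f y - b\<bar>} < dyadic_content \<phi> x l R"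
  shows "\<bar>a - b\<bar> \<le> 2 * s"
proof (rule ccontr)
  assume "\<not> \<bar>a - b\<bar> \<le> 2 * s"
  then have "s < \<bar>f y - a\<bar> \<or> s < \<bar>f y - b\<bar>" for y by linarith
  then have "R \<subseteq> {y \<in> R. s < \<bar>f y - a\<bar>} \<union> {y \<in> R. s < \<bar>f y - b\<bar>}" by auto
  then have "dyadic_content \<phi> x l R \<le> dyadic_content \<phi> x l {y \<in> R. s < \<bar>f y - a\<bar>} + dyadic_content \<phi> x l {y \<in> R. s < \<bar>f y - b\<bar>}"
    by (rule order_trans[OF content_mono content_Un_le])
  then show False using assms by simp
qed

lemma stopping_cubes:
  fixes x :: "real ^ 'n"
  assumes l: "0 < l" and \<phi>: "mono \<phi>"
    and E: "E \<subseteq> cell x l k w" "8 * dyadic_content \<phi> x l E \<le> dyadic_content \<phi> x l (cell x l k w)"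
    and pos: "0 < dyadic_content \<phi> x l (cell x l k w)" and fin: "dyadic_content \<phi> x l (cell x l k w) < top"
  obtains \<S> where "countable \<S>" "E \<subseteq> \<Union>\<S>"
    "2 * (\<Sum>\<^sub>\<infinity>S\<in>\<S>. dyadic_content \<phi> x l S) \<le> dyadic_content \<phi> x l (cell x l k w)"
    "\<And>S. S \<in> \<S> \<Longrightarrow> \<exists>j v. S = cell x l j v \<and> cell x l (j + 1) v \<subseteq> cell x l k w \<and>
      2 * dyadic_content \<phi> x l (E \<inter> cell x l (j + 1) v) < dyadic_content \<phi> x l (cell x l (j + 1) v)"
proof -
  let ?H = "dyadic_content \<phi> x l" and ?Q = "cell x l k w"
  obtain h where h: "?H ?Q = ennreal h" "0 < h"
    using pos fin by (cases "?H ?Q" rule: ennreal_cases) auto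
  have "?H E \<le> 8 * ?H E" using mult_right_mono[of 1 "8 :: ennreal" "?H E"] by simp
  then have "?H E < top" using E(2) fin by (meson le_less_trans)
  then obtain e where e: "?H E = ennreal e" "0 \<le> e" by (cases "?H E" rule: ennreal_cases) auto
  have "ennreal (8 * e) \<le> ennreal h" using E(2) e h by (simp add: ennreal_mult)
  then have eh: "8 * e \<le> h" using h by (simp add: ennreal_le_iff)
  \<comment> \<open>The strict gap between h / 8 and h / 4, available because h > 0, provides a
    cover even though the infimum in the content need not be attained.\<close>
  then have "?H E < ennreal (h / 4)" using e h by (simp add: ennreal_lessI)
  then obtain \<C> where C: "countable \<C>" "\<C> \<subseteq> dyadic x l" "E \<subseteq> \<Union>\<C>"
    and Csum: "(\<Sum>\<^sub>\<infinity>R\<in>\<C>. \<phi> (side_length R)) < ennreal (h / 4)"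
    by (rule content_cover_less)
  define \<Q> where "\<Q> = {R\<in>\<C>. R \<inter> ?Q \<noteq> {}}"
  define \<G> where "\<G> = {R\<in>finite_dyadic x l. R \<subseteq> ?Q \<and> ?H R \<le> 2 * ?H (E \<inter> R)}"
  define \<S> where "\<S> = {S \<in> \<Q> \<union> \<G>. \<forall>T\<in>\<Q> \<union> \<G>. S \<subseteq> T \<longrightarrow> S = T}"
  \<comment> \<open>A cover member containing the whole cube would alone cost h. By
    \<open>dyadic_meets_cell\<close>, the members of \<Q> are therefore finite proper
    subcubes.\<close>
  have notsup: "\<not> ?Q \<subseteq> R" if "R \<in> \<C>" for R
  proof
    assume "?Q \<subseteq> R"
    then have "?H ?Q \<le> \<phi> (side_length R)" using that C(2) by (intro content_le_single) auto
    also have "\<dots> \<le> (\<Sum>\<^sub>\<infinity>R\<in>\<C>. \<phi> (side_length R))"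
      using infsum_ennreal_mono_set[of "{R}" \<C> "\<lambda>R. \<phi> (side_length R)"] that by simp
    also note Csum
    finally show False using h by (simp add: ennreal_less_iff)
  qed
  have Qcell: "\<exists>j v. R = cell x l j v" "R \<subset> ?Q" if "R \<in> \<Q>" for R
    using dyadic_meets_cell[OF l, of R x k w] notsup[of R] that C(2) by (auto simp: \<Q>_def)
  have Gcell: "\<exists>j v. R = cell x l j v" "R \<subset> ?Q" if "R \<in> \<G>" for R
  proof -
    show "\<exists>j v. R = cell x l j v" using that finite_dyadic_eq[OF l] by (auto simp: \<G>_def)
    \<comment> \<open>The ambient cube is no candidate, as E fills at most an eighth of it. So every
      candidate is a proper subcube, whose parent still lies in the ambient cube.\<close>
    have "\<not> ?H ?Q \<le> 2 * ?H (E \<inter> ?Q)"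
    proof
      assume "?H ?Q \<le> 2 * ?H (E \<inter> ?Q)"
      also have "E \<inter> ?Q = E" using E(1) by auto
      finally have "ennreal h \<le> ennreal (2 * e)" using e h by (simp add: ennreal_mult)
      then show False using e eh h by (simp add: ennreal_le_iff)
    qed
    then show "R \<subset> ?Q" using that by (auto simp: \<G>_def)
  qed
  have QG: "\<exists>j v. R = cell x l j v" "R \<subset> ?Q" if "R \<in> \<Q> \<union> \<G>" for R
    using that Qcell[of R] Gcell[of R] by blast+
  have max: "\<exists>S\<in>\<S>. R \<subseteq> S" if "R \<in> \<Q> \<union> \<G>" for R
  proof -
    have sub: "\<Q> \<union> \<G> \<subseteq> finite_dyadic x l" using QG(1) unfolding finite_dyadic_eq[OF l] by blast
    have "A \<subseteq> ?Q" if "A \<in> \<Q> \<union> \<G>" for A using QG(2)[OF that] by (rule psubset_imp_subset)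
    then show ?thesis
    proof (rule ex_maximal_cell[OF l sub _ that])
      fix S assume "S \<in> \<Q> \<union> \<G>" "R \<subseteq> S" "\<And>T. T \<in> \<Q> \<union> \<G> \<Longrightarrow> S \<subseteq> T \<Longrightarrow> S = T"
      then show ?thesis unfolding \<S>_def by blast
    qed
  qed
  have nested: "R \<subseteq> T \<or> T \<subseteq> R" if "R \<in> \<Q> \<union> \<G>" "T \<in> \<Q> \<union> \<G>" "z \<in> R" "z \<in> T" for R T z
  proof -
    note QG(1)[OF that(1)] QG(1)[OF that(2)]
    then obtain i u j v where "R = cell x l i u" "T = cell x l j v" by blast
    then show ?thesis using cell_nested[of z x l i u j v] cell_nested[of z x l j v i u] that
      by (cases "i \<le> j") auto
  qed
  have cS: "countable \<S>"
  proof (rule countable_subset)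
    have "\<Q> \<union> \<G> \<subseteq> dyadic x l" using QG(1) cell_in_dyadic[OF l] by blast
    then show "\<S> \<subseteq> dyadic x l" unfolding \<S>_def by blast
  qed (rule countable_dyadic)
  have cQ: "countable \<Q>" using C(1) by (simp add: \<Q>_def)
  have EQ: "E \<subseteq> \<Union>\<Q>" using C(3) E(1) unfolding \<Q>_def by blast
  have cover: "E \<subseteq> \<Union>\<S>"
  proof
    fix y assume "y \<in> E"
    then obtain R where "R \<in> \<Q>" "y \<in> R" using EQ by blast
    then show "y \<in> \<Union>\<S>" using max[of R] by blast
  qed
  \<comment> \<open>The substitute for additivity. If S is maximal but not in the cover, a cover
    member meeting S cannot strictly contain it, hence lies inside S. So the members inside S cover
    E \<inter> S, and the stopping rule bounds ?H S by twice their cost.\<close>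
  have HS: "?H S \<le> (\<Sum>\<^sub>\<infinity>R\<in>{R\<in>\<Q>. R \<subseteq> S}. 2 * \<phi> (side_length R))" if S: "S \<in> \<S>" for S
  proof (cases "S \<in> \<Q>")
    case True
    have "?H S \<le> 1 * \<phi> (side_length S)"
      using True C(2) content_le_single[of S x l S \<phi>] by (auto simp: \<Q>_def)
    also have "\<dots> \<le> 2 * \<phi> (side_length S)" by (rule mult_right_mono) auto
    also have "\<dots> \<le> (\<Sum>\<^sub>\<infinity>R\<in>{R\<in>\<Q>. R \<subseteq> S}. 2 * \<phi> (side_length R))"
      using infsum_ennreal_mono_set[of "{S}" "{R\<in>\<Q>. R \<subseteq> S}" "\<lambda>R. 2 * \<phi> (side_length R)"] True by simp
    finally show ?thesis .
  next
    case False
    then have "S \<in> \<G>" using S by (auto simp: \<S>_def)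
    have sub: "R \<subseteq> S" if "R \<in> \<Q>" "z \<in> R" "z \<in> S" for R z
      using nested[of R S z] that S unfolding \<S>_def by blast
    have "?H (E \<inter> S) \<le> (\<Sum>\<^sub>\<infinity>R\<in>{R\<in>\<Q>. R \<subseteq> S}. \<phi> (side_length R))"
    proof (rule content_le_cover)
      show "countable {R\<in>\<Q>. R \<subseteq> S}" using cQ by simp
      show "{R\<in>\<Q>. R \<subseteq> S} \<subseteq> dyadic x l" using C(2) by (auto simp: \<Q>_def)
      show "E \<inter> S \<subseteq> \<Union>{R\<in>\<Q>. R \<subseteq> S}"
      proof
        fix z assume z: "z \<in> E \<inter> S"
        then obtain R where R: "R \<in> \<Q>" "z \<in> R" using EQ by blast
        then have "R \<subseteq> S" using sub z by simp
        then show "z \<in> \<Union>{R\<in>\<Q>. R \<subseteq> S}" using R by blast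
      qed
    qed
    then have "2 * ?H (E \<inter> S) \<le> 2 * (\<Sum>\<^sub>\<infinity>R\<in>{R\<in>\<Q>. R \<subseteq> S}. \<phi> (side_length R))"
      by (rule mult_left_mono) simp
    also have "\<dots> = (\<Sum>\<^sub>\<infinity>R\<in>{R\<in>\<Q>. R \<subseteq> S}. 2 * \<phi> (side_length R))"
      using cQ by (intro infsum_ennreal_cmult[symmetric]) simp
    finally show ?thesis using \<open>S \<in> \<G>\<close> unfolding \<G>_def by auto
  qed
  have "(\<Sum>\<^sub>\<infinity>S\<in>\<S>. ?H S) \<le> (\<Sum>\<^sub>\<infinity>S\<in>\<S>. \<Sum>\<^sub>\<infinity>R\<in>{R\<in>\<Q>. R \<subseteq> S}. 2 * \<phi> (side_length R))"
    by (intro infsum_mono nonneg_summable_on_complete HS zero_le)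
  also have "\<dots> \<le> (\<Sum>\<^sub>\<infinity>R\<in>\<Q>. 2 * \<phi> (side_length R))"
  \<comment> \<open>A cover member inside two maximal cubes makes them meet, hence nest, hence
    coincide by maximality.\<close>
  proof (rule infsum_ennreal_disjoint_classes_le[OF cQ cS])
    fix R S T assume R: "R \<in> \<Q>" and ST: "S \<in> \<S>" "T \<in> \<S>" "R \<subseteq> S" "R \<subseteq> T"
    obtain j v where "R = cell x l j v" using Qcell(1)[OF R] by blast
    then have v: "v \<in> S" "v \<in> T" using ST(3,4) cell_refl by auto
    have mem: "S \<in> \<Q> \<union> \<G>" "T \<in> \<Q> \<union> \<G>" using ST(1,2) by (auto simp: \<S>_def)
    show "S = T" using nested[OF mem v] mem ST(1,2) by (auto simp: \<S>_def)
  qed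
  also have "\<dots> = 2 * (\<Sum>\<^sub>\<infinity>R\<in>\<Q>. \<phi> (side_length R))" by (rule infsum_ennreal_cmult[OF cQ])
  also have "(\<Sum>\<^sub>\<infinity>R\<in>\<Q>. \<phi> (side_length R)) \<le> (\<Sum>\<^sub>\<infinity>R\<in>\<C>. \<phi> (side_length R))"
    by (rule infsum_ennreal_mono_set) (auto simp: \<Q>_def)
  also have "\<dots> \<le> ennreal (h / 4)" using Csum by simp
  finally have "(\<Sum>\<^sub>\<infinity>S\<in>\<S>. ?H S) \<le> 2 * ennreal (h / 4)" by (simp add: mult_left_mono)
  then have "2 * (\<Sum>\<^sub>\<infinity>S\<in>\<S>. ?H S) \<le> 2 * (2 * ennreal (h / 4))" by (rule mult_left_mono) simp
  also have "\<dots> = ennreal (2 * (2 * (h / 4)))"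
    using h(2) ennreal_mult[of 2 "2 * (h / 4)"] ennreal_mult[of 2 "h / 4"] by simp
  also have "\<dots> = ?H ?Q" by (simp add: h)
  finally have sum: "2 * (\<Sum>\<^sub>\<infinity>S\<in>\<S>. ?H S) \<le> ?H ?Q" .
  have parent: "\<exists>j v. S = cell x l j v \<and> cell x l (j + 1) v \<subseteq> ?Q \<and>
      2 * ?H (E \<inter> cell x l (j + 1) v) < ?H (cell x l (j + 1) v)" if S: "S \<in> \<S>" for S
  proof -
    have SQG: "S \<in> \<Q> \<union> \<G>" using S by (simp add: \<S>_def)
    obtain j v where Sj: "S = cell x l j v" using QG(1)[OF SQG] by blast
    let ?P = "cell x l (j + 1) v"
    have PQ: "?P \<subseteq> ?Q" using parent_subset[OF l] QG(2)[OF SQG] Sj by blast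
    \<comment> \<open>Maximality excludes only strictly larger candidates, so the parent must be
      known to differ from S before it can be ruled out of \<G>.\<close>
    have "S \<noteq> ?P"
    proof
      assume "S = ?P"
      then have "side_length S = side_length ?P" by simp
      then have "ennreal (2 powi j * l) = ennreal (2 powi (j + 1) * l)" unfolding Sj side_length_cell[OF l] .
      then show False using l by (simp add: power_int_add)
    qed
    then have "?P \<notin> \<G>" using S cell_mono_Suc[of x l j v] unfolding Sj \<S>_def by blast
    moreover have "?P \<in> finite_dyadic x l" using finite_dyadic_eq[OF l] by blast
    ultimately have "2 * ?H (E \<inter> ?P) < ?H ?P" using PQ by (auto simp: \<G>_def not_le)
    then show ?thesis using Sj PQ by blast
  qed
  show thesis by (rule that[OF cS cover sum parent])
qed

text \<open>The induction runs over all subcubes of Q0 at once, with one constant c R fixed for each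
  cube R, so that the hypothesis applies to the stopping cubes with their own constants. The slack 4
  s per step is 2 s from the cube to the parent P and 2 s from P to S.\<close>

lemma superlevel_content_geometric_decay:
  fixes x :: "real ^ 'n" and f :: "real ^ 'n \<Rightarrow> real" and c :: "(real ^ 'n) set \<Rightarrow> real"
  assumes l: "0 < l" and \<phi>: "mono \<phi>" "(\<phi> \<longlongrightarrow> 0) (at_right 0)" and s: "0 \<le> s"
    and weak: "\<And>j v. cell x l j v \<subseteq> Q0 \<Longrightarrow>
      8 * (2 ^ CARD('n) * dyadic_content \<phi> x l {y \<in> cell x l j v. s < \<bar>f y - c (cell x l j v)\<bar>})
        \<le> dyadic_content \<phi> x l (cell x l j v)"
    and sub: "cell x l k w \<subseteq> Q0"
  shows "2 ^ n * dyadic_content \<phi> x l {y \<in> cell x l k w. 4 * s * real n < \<bar>f y - c (cell x l k w)\<bar>}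
    \<le> dyadic_content \<phi> x l (cell x l k w)"
  using sub
proof (induction n arbitrary: k w)
  case 0
  then show ?case by (simp add: content_mono)
next
  case (Suc n)
  let ?H = "dyadic_content \<phi> x l" and ?Q = "cell x l k w" and ?D = "2 ^ CARD('n) :: ennreal"
  define F where "F = {y \<in> ?Q. 4 * s * real (Suc n) < \<bar>f y - c ?Q\<bar>}"
  define E where "E = {y \<in> ?Q. s < \<bar>f y - c ?Q\<bar>}"
  have D1: "1 \<le> ?D" by (rule one_le_power) simp
  have Dtop: "?D < top" by (simp add: power_less_top_ennreal)
  have weak1: "8 * ?H {y \<in> cell x l j v. s < \<bar>f y - c (cell x l j v)\<bar>} \<le> ?H (cell x l j v)"
    if "cell x l j v \<subseteq> Q0" for j v
  proof -
    have "1 * ?H {y \<in> cell x l j v. s < \<bar>f y - c (cell x l j v)\<bar>}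
      \<le> ?D * ?H {y \<in> cell x l j v. s < \<bar>f y - c (cell x l j v)\<bar>}"
      using D1 by (rule mult_right_mono) simp
    then have "8 * ?H {y \<in> cell x l j v. s < \<bar>f y - c (cell x l j v)\<bar>}
      \<le> 8 * (?D * ?H {y \<in> cell x l j v. s < \<bar>f y - c (cell x l j v)\<bar>})"
      by (intro mult_left_mono) auto
    then show ?thesis using weak[OF that] by (rule order_trans)
  qed
  have two_le: "2 * a \<le> b" if "8 * a \<le> b" for a b :: ennreal
    using mult_right_mono[of 2 "8 :: ennreal" a] that by (simp add: order_trans)
  have fin: "?H (cell x l j v) < top" for j v by (rule content_cell_less_top[OF l \<phi>])
  have FQ: "F \<subseteq> ?Q" by (auto simp: F_def)
  have "2 ^ Suc n * ?H F \<le> ?H ?Q"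
  \<comment> \<open>Cubes may have content zero, for instance when \<phi> vanishes identically; the
    stopping construction needs positive content.\<close>
  proof (cases "?H ?Q = 0")
    case True
    then show ?thesis using content_mono[OF FQ, of \<phi> x l] by simp
  next
    case False
    then have pos: "0 < ?H ?Q" by (simp add: zero_less_iff_neq_zero)
    have EQ: "E \<subseteq> ?Q" by (auto simp: E_def)
    have E8: "8 * ?H E \<le> ?H ?Q" unfolding E_def by (rule weak1[OF Suc.prems])
    obtain \<S> where S: "countable \<S>" "E \<subseteq> \<Union>\<S>" "2 * (\<Sum>\<^sub>\<infinity>S\<in>\<S>. ?H S) \<le> ?H ?Q"
      and parent: "\<And>S. S \<in> \<S> \<Longrightarrow> \<exists>j v. S = cell x l j v \<and> cell x l (j + 1) v \<subseteq> ?Q \<and>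
        2 * ?H (E \<inter> cell x l (j + 1) v) < ?H (cell x l (j + 1) v)"
      using stopping_cubes[OF l \<phi>(1) EQ E8 pos fin] by blast
    have near: "\<bar>c S - c ?Q\<bar> \<le> 4 * s \<and> 2 ^ n * ?H {y \<in> S. 4 * s * real n < \<bar>f y - c S\<bar>} \<le> ?H S"
      if "S \<in> \<S>" for S
    proof -
      obtain j v where Sj: "S = cell x l j v" and PQ: "cell x l (j + 1) v \<subseteq> ?Q"
        and EP: "2 * ?H (E \<inter> cell x l (j + 1) v) < ?H (cell x l (j + 1) v)"
        using parent[OF \<open>S \<in> \<S>\<close>] by blast
      let ?P = "cell x l (j + 1) v"
      have SP: "S \<subseteq> ?P" unfolding Sj by (rule cell_mono_Suc)
      have sub: "?P \<subseteq> Q0" "S \<subseteq> Q0" using PQ SP Suc.prems by auto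
      have dbl: "?H ?P \<le> ?D * ?H S" unfolding Sj by (rule content_cell_Suc_le[OF l \<phi>(1)])
      have "0 < ?H ?P" using EP by (rule le_less_trans[rotated]) simp
      \<comment> \<open>The strict inequality at the parent makes its content positive, and doubling
        passes this on to S. It will be needed to turn one eighth of ?H S into strictly less than
        one half.\<close>
      then have S0: "0 < ?H S" using dbl by (metis mult_zero_right not_gr_zero not_less)
      have "\<bar>c ?Q - c ?P\<bar> \<le> 2 * s"
      proof (rule abs_diff_le_of_small_superlevels)
        have "{y \<in> ?P. s < \<bar>f y - c ?Q\<bar>} = E \<inter> ?P" using PQ by (auto simp: E_def)
        then show "?H {y \<in> ?P. s < \<bar>f y - c ?Q\<bar>} + ?H {y \<in> ?P. s < \<bar>f y - c ?P\<bar>} < ?H ?P"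
          using ennreal_add_less_of_halves[OF EP two_le[OF weak1[OF sub(1)]] fin] by simp
      qed
      moreover have "\<bar>c S - c ?P\<bar> \<le> 2 * s"
      proof (rule abs_diff_le_of_small_superlevels, rule ennreal_add_less_of_halves)
        show "?H S < top" unfolding Sj by (rule fin)
        have 8: "8 * ?H {y \<in> S. s < \<bar>f y - c S\<bar>} \<le> ?H S" using weak1 sub(2) unfolding Sj by blast
        show "2 * ?H {y \<in> S. s < \<bar>f y - c S\<bar>} < ?H S"
        proof (rule ccontr)
          assume "\<not> ?thesis"
          then have "?H S \<le> 2 * ?H {y \<in> S. s < \<bar>f y - c S\<bar>}" by simp
          then have "4 * ?H S \<le> 4 * (2 * ?H {y \<in> S. s < \<bar>f y - c S\<bar>})" by (rule mult_left_mono) simp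
          also have "\<dots> = 8 * ?H {y \<in> S. s < \<bar>f y - c S\<bar>}" by (simp flip: mult.assoc)
          also note 8
          finally have "4 * ?H S \<le> ?H S" .
          moreover obtain r where "?H S = ennreal r" "0 < r"
            using S0 \<open>?H S < top\<close> by (cases "?H S" rule: ennreal_cases) auto
          ultimately have "ennreal (4 * r) \<le> ennreal r" by (simp add: ennreal_mult)
          then show False using \<open>0 < r\<close> by (simp add: ennreal_le_iff)
        qed
        \<comment> \<open>The factor ?D in \<open>weak\<close> is spent here: the exceptional set of
          P has content at most ?H ?P / (8 * ?D), which doubling bounds by ?H S / 8.\<close>
        have "?D * (8 * ?H {y \<in> S. s < \<bar>f y - c ?P\<bar>}) \<le> 8 * (?D * ?H {y \<in> ?P. s < \<bar>f y - c ?P\<bar>})"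
          using SP content_mono[of "{y \<in> S. s < \<bar>f y - c ?P\<bar>}" "{y \<in> ?P. s < \<bar>f y - c ?P\<bar>}" \<phi> x l]
          by (subst mult.left_commute) (intro mult_left_mono, auto)
        also have "\<dots> \<le> ?H ?P" by (rule weak[OF sub(1)])
        also note dbl
        finally have "8 * ?H {y \<in> S. s < \<bar>f y - c ?P\<bar>} \<le> ?H S"
          using D1 Dtop by (subst (asm) ennreal_mult_le_mult_iff) auto
        then show "2 * ?H {y \<in> S. s < \<bar>f y - c ?P\<bar>} \<le> ?H S" by (rule two_le)
      qed
      ultimately have "\<bar>c S - c ?Q\<bar> \<le> 4 * s" by linarith
      moreover have "2 ^ n * ?H {y \<in> S. 4 * s * real n < \<bar>f y - c S\<bar>} \<le> ?H S"
        using Suc.IH[of j v] sub(2) unfolding Sj by blast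
      ultimately show ?thesis by simp
    qed
    \<comment> \<open>A point of F belongs to E, hence to some S, and replacing c ?Q by c S lowers
      its deviation by at most 4 s.\<close>
    have "F \<subseteq> (\<Union>S\<in>\<S>. {y \<in> S. 4 * s * real n < \<bar>f y - c S\<bar>})"
    proof
      fix y assume y: "y \<in> F"
      then have y1: "y \<in> ?Q" "4 * s * real n + 4 * s < \<bar>f y - c ?Q\<bar>" by (auto simp: F_def algebra_simps)
      moreover have "s \<le> 4 * s * real n + 4 * s" using s by (simp add: add_increasing)
      ultimately have "y \<in> E" by (auto simp: E_def)
      then obtain S where "S \<in> \<S>" "y \<in> S" using S(2) by blast
      moreover from this have "4 * s * real n < \<bar>f y - c S\<bar>" using near[of S] y1(2) by linarith
      ultimately show "y \<in> (\<Union>S\<in>\<S>. {y \<in> S. 4 * s * real n < \<bar>f y - c S\<bar>})" by blast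
    qed
    then have "?H F \<le> ?H (\<Union>S\<in>\<S>. {y \<in> S. 4 * s * real n < \<bar>f y - c S\<bar>})" by (rule content_mono)
    also have "\<dots> \<le> (\<Sum>\<^sub>\<infinity>S\<in>\<S>. ?H {y \<in> S. 4 * s * real n < \<bar>f y - c S\<bar>})"
      by (rule content_Union_le[OF S(1)])
    finally have "2 ^ n * ?H F \<le> 2 ^ n * (\<Sum>\<^sub>\<infinity>S\<in>\<S>. ?H {y \<in> S. 4 * s * real n < \<bar>f y - c S\<bar>})"
      by (rule mult_left_mono) simp
    also have "\<dots> = (\<Sum>\<^sub>\<infinity>S\<in>\<S>. 2 ^ n * ?H {y \<in> S. 4 * s * real n < \<bar>f y - c S\<bar>})"
      by (rule infsum_ennreal_cmult[OF S(1), symmetric])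
    also have "\<dots> \<le> (\<Sum>\<^sub>\<infinity>S\<in>\<S>. ?H S)"
      using near by (intro infsum_mono nonneg_summable_on_complete zero_le) blast
    finally have "2 * (2 ^ n * ?H F) \<le> 2 * (\<Sum>\<^sub>\<infinity>S\<in>\<S>. ?H S)" by (rule mult_left_mono) simp
    then show ?thesis using S(3) by (simp add: mult.assoc order_trans)
  qed
  then show ?case by (simp only: F_def)
qed

text \<open>Rounding t / s down loses at most one power of 2, which is the factor 2 and later the
  constant C.\<close>

lemma geometric_le_exponential:
  fixes t s :: real
  assumes "0 < s" "0 \<le> t"
  shows "1 \<le> 2 ^ nat \<lfloor>t / s\<rfloor> * (2 * exp (- (ln 2 * t / s)))"
proof -
  have "t / s \<le> real (nat \<lfloor>t / s\<rfloor>) + 1" using assms by linarith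
  then have "exp (ln 2 * (t / s)) \<le> exp (ln 2 * (real (nat \<lfloor>t / s\<rfloor>) + 1))"
    unfolding exp_le_cancel_iff by (rule mult_left_mono) simp
  also have "\<dots> = 2 * 2 ^ nat \<lfloor>t / s\<rfloor>"
    using exp_of_nat_mult[of "nat \<lfloor>t / s\<rfloor>" "ln 2 :: real"] by (simp add: distrib_left exp_add mult.commute)
  finally show ?thesis by (simp add: exp_minus field_simps)
qed

theorem theorem4:
  fixes \<phi> :: "ennreal \<Rightarrow> ennreal" and x :: "real ^ 'n" and l :: real and Q0 :: "(real ^ 'n) set"
  assumes "0 < l"
    and "mono \<phi>"
    and "(\<phi> \<longlongrightarrow> 0) (at_right 0)"
    and "Q0 \<in> dyadic x l"
  shows "\<exists>c C :: real. 0 < c \<and> 0 < C \<and>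
    (\<forall>f \<in> BMO \<phi> x l Q0. \<forall>Q' \<in> finite_dyadic x l. Q' \<subseteq> Q0 \<longrightarrow>
      (\<exists>cQ. is_oscillation_minimizer \<phi> x l Q' f cQ) \<and>
      (\<forall>cQ. is_oscillation_minimizer \<phi> x l Q' f cQ \<longrightarrow>
        (\<forall>t>0. dyadic_content \<phi> x l {y \<in> Q'. t < \<bar>f y - cQ\<bar>}
          \<le> ennreal C * dyadic_content \<phi> x l Q' * ennreal (exp_decay c t (BMO_norm \<phi> x l Q0 f)))))"
proof -
  let ?H = "dyadic_content \<phi> x l"
  define D :: real where "D = 2 ^ CARD('n)"
  have D: "0 < D" "ennreal D = 2 ^ CARD('n)" by (simp_all add: D_def flip: ennreal_power)
  have fin: "?H (cell x l j v) < top" for j v by (rule content_cell_less_top[OF assms(1-3)])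
  have ex: "\<exists>cQ. is_oscillation_minimizer \<phi> x l (cell x l j v) f cQ" for f j v
    unfolding oscillation_minimizer_iff
    by (rule ex_choquet_average_minimizer[OF content_mono content_Un_le fin])
  have decay: "?H {y \<in> cell x l k w. t < \<bar>f y - cQ\<bar>}
      \<le> ennreal 2 * ?H (cell x l k w) * ennreal (exp_decay (ln 2 / (32 * D)) t (BMO_norm \<phi> x l Q0 f))"
    if f: "f \<in> BMO \<phi> x l Q0" and sub: "cell x l k w \<subseteq> Q0"
      and cQ: "is_oscillation_minimizer \<phi> x l (cell x l k w) f cQ" and t: "0 < t" for f k w cQ t
  proof -
    let ?N = "BMO_norm \<phi> x l Q0 f"
    have cheb: "ennreal r * ?H {y \<in> cell x l j v. r < \<bar>f y - d\<bar>} \<le> ?N * ?H (cell x l j v)"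
      if "0 \<le> r" "cell x l j v \<subseteq> Q0" "is_oscillation_minimizer \<phi> x l (cell x l j v) f d" for r j v d
      using choquet_chebyshev[of ?H r "cell x l j v" "\<lambda>y. \<bar>f y - d\<bar>", OF content_mono that(1)]
        oscillation_le_BMO_norm[OF assms that(2,3)] by (rule order_trans)
    show ?thesis
    proof (cases "?N = 0")
      case True
      \<comment> \<open>With norm zero, Chebyshev at level t already makes the superlevel set have
        content zero, in agreement with reading the exponential as 0.\<close>
      then have "ennreal t * ?H {y \<in> cell x l k w. t < \<bar>f y - cQ\<bar>} = 0" using cheb[OF _ sub cQ, of t] t by simp
      then show ?thesis using t by simp
    next
      case False
      obtain n where n: "?N = ennreal n" "0 < n"
        using f False by (cases ?N rule: ennreal_cases) (auto simp: BMO_def)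
      \<comment> \<open>The minimizer on the given cube is prescribed and may not be the chosen one,
        since minimizers need not be unique; all other cubes take any minimizer.\<close>
      define c where "c R = (if R = cell x l k w then cQ else SOME d. is_oscillation_minimizer \<phi> x l R f d)" for R
      have c: "is_oscillation_minimizer \<phi> x l (cell x l j v) f (c (cell x l j v))" for j v
        using cQ someI_ex[OF ex[of j v f]] by (simp add: c_def)
      \<comment> \<open>Chebyshev bounds the content of the exceptional set by the share n / s = 1 /
        (8 * D), which is what \<open>weak\<close> asks for.\<close>
      define s where "s = 8 * D * n"
      have s: "0 < s" using D n by (simp add: s_def)
      have weak: "8 * (2 ^ CARD('n) * ?H {y \<in> cell x l j v. s < \<bar>f y - c (cell x l j v)\<bar>}) \<le> ?H (cell x l j v)"
        if "cell x l j v \<subseteq> Q0" for j v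
      proof -
        let ?X = "?H {y \<in> cell x l j v. s < \<bar>f y - c (cell x l j v)\<bar>}"
        have "ennreal n * (8 * (ennreal D * ?X)) = ennreal s * ?X"
          using D n by (simp add: s_def ennreal_mult ac_simps)
        also have "\<dots> \<le> ennreal n * ?H (cell x l j v)" using cheb[OF _ that c] s n by simp
        finally show ?thesis using n by (subst (asm) ennreal_mult_le_mult_iff) (auto simp: D)
      qed
      define m where "m = nat \<lfloor>t / (4 * s)\<rfloor>"
      let ?X = "?H {y \<in> cell x l k w. t < \<bar>f y - cQ\<bar>}" and ?e = "exp (- (ln 2 * t / (4 * s)))"
      have "4 * s * real m \<le> t"
      proof -
        have "real m \<le> t / (4 * s)" using s t by (simp add: m_def)
        then show ?thesis using s by (simp add: field_simps)
      qed
      then have "?X \<le> ?H {y \<in> cell x l k w. 4 * s * real m < \<bar>f y - c (cell x l k w)\<bar>}"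
        by (intro content_mono) (auto simp: c_def)
      then have "2 ^ m * ?X \<le> 2 ^ m * ?H {y \<in> cell x l k w. 4 * s * real m < \<bar>f y - c (cell x l k w)\<bar>}"
        by (rule mult_left_mono) simp
      also have "\<dots> \<le> ?H (cell x l k w)"
        using s by (intro superlevel_content_geometric_decay[OF assms(1-3) _ weak sub]) auto
      finally have geo: "ennreal (2 ^ m) * ?X \<le> ?H (cell x l k w)" by (simp flip: ennreal_power)
      have "?X = ennreal 1 * ?X" by simp
      also have "\<dots> \<le> ennreal (2 ^ m * (2 * ?e)) * ?X"
        using geometric_le_exponential[of "4 * s" t] s t unfolding m_def by (intro mult_right_mono ennreal_leI) auto
      also have "\<dots> = ennreal (2 * ?e) * (ennreal (2 ^ m) * ?X)" by (simp add: ennreal_mult ac_simps)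
      also have "\<dots> \<le> ennreal (2 * ?e) * ?H (cell x l k w)" using geo by (rule mult_left_mono) simp
      also have "\<dots> = ennreal 2 * ?H (cell x l k w) * ennreal ?e" by (simp add: ennreal_mult ac_simps)
      also have "?e = exp_decay (ln 2 / (32 * D)) t ?N"
        using n by (simp add: exp_decay_def s_def)
      finally show ?thesis .
    qed
  qed
  have "0 < ln 2 / (32 * D)" using D by simp
  then show ?thesis
    using ex decay unfolding finite_dyadic_eq[OF assms(1)]
    by (intro exI[of _ "ln 2 / (32 * D)"] exI[of _ 2]) auto
qed

end
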